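(* Let $(A_n)_{n\ge 0}$ be the sequence determined by $A_0=1,\ A_1=1,\ A_2=6,\ A_3=30,\ A_4=175,\ A_5=1087$ and, for all $n\ge 6$, $$\begin{aligned}&(-54+54n-18n^2+2n^3)A_{n-6}+(190-226n+90n^2-12n^3)A_{n-5}+(312-428n+204n^2-34n^3)A_{n-4}\\&+(168-292n+180n^2-40n^3)A_{n-3}+(54-122n+102n^2-34n^3)A_{n-2}+(2-10n+18n^2-12n^3)A_{n-1}+2n^3A_n=0.\end{aligned}$$ Then $$\frac1\pi=\sum_{n=0}^{\infty}A_n\,(Bn+C)\left(7-4\sqrt3\right)^n,$$ where $$B=-16(-2+\sqrt3)\sqrt{3(97-56\sqrt3)},$$ $$C=4\left(14\sqrt{97-56\sqrt3}-7\sqrt{3(97-56\sqrt3)}+3(-3064+1769\sqrt3)\sqrt{97+56\sqrt3}\right).$$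
   Context: All square roots are the nonnegative real square roots. (This is the level $20$ series, for the group $20+20$.) *)

theory Defs
  imports "HOL-Analysis.Analysis"
begin

end

theory Submission
  imports Defs "HOL-Real_Asymp.Real_Asymp"
begin

text \<open>
  Let \<open>F(t) = 2F1(1/2, 1/2; 1; t)\<close>, which is \<open>2K/pi\<close> at \<open>k\<^sup>2 = t\<close>, and let \<open>Z\<close> be the generating function of the sequence. In modular
  terms \<open>x\<close> is a Hauptmodul for the group \<open>20+20\<close>, \<open>Z\<close> is a form of weight two, and \<open>x = 7 - 4 sqrt 3\<close> is its value at the CM
  point \<open>tau = i sqrt(3/20)\<close>. The proof is a real-variable version of this picture and uses only differential
  equations.

  Three relations hold at that point. First, with \<open>lam_1\<close> and \<open>lam_5\<close> the lambda functions at \<open>2 tau\<close> and \<open>10 tau\<close>,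
  written as explicit algebraic functions of \<open>x\<close>, one has \<open>Z = F(lam_1)\<^sup>2 / g_1 = 5 F(lam_5)\<^sup>2 / g_5\<close> with algebraic
  \<open>g_1\<close>, \<open>g_5\<close> (\<open>genfun_0_eq_hypF\<close>). In particular \<open>F(lam_1)\<close> and \<open>F(lam_5)\<close> are related by a transformation of degree five.
  Second, the cubic transformation \<open>F(alpha) = (1 + 2p) F(beta)\<close> (\<open>cubic_transformation\<close>) applies with \<open>beta = lam_1\<close> and
  \<open>alpha = 1 - lam_5\<close>; this coincidence is what distinguishes the CM point. Third, Legendre's
  relation expresses \<open>1/pi\<close> through \<open>F\<close> and \<open>F'\<close> at \<open>lam_5\<close> and \<open>1 - lam_5\<close> (\<open>hypF_legendre\<close>). By the first two
  relations and their derivatives all these quantities are expressed through \<open>Z\<close> and \<open>x Z'\<close>, and the third one becomes the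
  claimed series (\<open>ramanujan_identity\<close>).

  Both transformation formulas are proved by one principle. An algebraic change of variable, put into Liouville
  normal form, turns the hypergeometric equation into \<open>D (D y) = R y\<close> (\<open>pull_y_v_DERIV\<close>). If two changes of variable lead to the same
  potential \<open>R\<close>, the pulled-back functions are proportional, since the equation has only one solution without logarithm at \<open>0\<close>
  (\<open>proportional_solutions\<close>). The recurrence of the sequence is the symmetric square of such an equation, which identifies \<open>Z\<close>
  with the square of a pull-back (\<open>symmetric_square_solution\<close>). Equality of potentials is a polynomial identity on the
  curve \<open>s\<^sup>2 = 1 - 8x - 2x\<^sup>2 - 8x\<^sup>3 + x\<^sup>4\<close> (\<open>level20_potential\<close>) or in the parameter \<open>p\<close> (\<open>cubic_potential\<close>).
\<close>

section \<open>The complete elliptic integral as a power series, and the Legendre relation\<close>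

text \<open>
  These are the squares of \<open>binom(2n,n) / 4^n\<close>, so \<open>hypF\<close> below is
  \<open>2F1(1/2, 1/2; 1; t)\<close>, that is \<open>2/pi\<close> times the complete elliptic integral \<open>K\<close> with \<open>k\<^sup>2 = t\<close>.
\<close>

primrec hyp_coeff :: "nat \<Rightarrow> real" where
  "hyp_coeff 0 = 1"
| "hyp_coeff (Suc n) = hyp_coeff n * ((2 * real n + 1) / (2 * real n + 2))\<^sup>2"

definition hypF :: "real \<Rightarrow> real" where
  "hypF t = (\<Sum>n. hyp_coeff n * t ^ n)"

text \<open>
  The function \<open>hypG\<close> is \<open>t (1 - t) F'(t)\<close>, the flux in the self-adjoint form
  \<open>(t (1 - t) F')' = F / 4\<close> of the hypergeometric equation. Its coefficients are written as differences of
  \<open>n c_n\<close> so that their sum, the value of the flux at \<open>t = 1\<close>, telescopes.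
\<close>

definition flux_coeff :: "nat \<Rightarrow> real" where
  "flux_coeff n = real n * hyp_coeff n - real (n - 1) * hyp_coeff (n - 1)"

definition hypG :: "real \<Rightarrow> real" where
  "hypG t = (\<Sum>n. flux_coeff n * t ^ n)"

lemma hyp_coeff_pos: "hyp_coeff n > 0"
  by (induction n) (auto intro!: mult_pos_pos divide_pos_pos zero_less_power)

lemma hyp_coeff_decreasing: "hyp_coeff (Suc n) \<le> hyp_coeff n"
proof -
  have "((2 * real n + 1) / (2 * real n + 2))\<^sup>2 \<le> 1"
    by (rule power_le_one) auto
  then show ?thesis
    using mult_left_mono[of _ 1 "hyp_coeff n"] hyp_coeff_pos[of n] by simp
qed

lemma hyp_coeff_le_1: "hyp_coeff n \<le> 1"
  by (induction n) (use hyp_coeff_decreasing order_trans in \<open>auto simp del: hyp_coeff.simps(2)\<close>)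

lemma flux_coeff_0 [simp]: "flux_coeff 0 = 0"
  by (simp add: flux_coeff_def)

text \<open>
  The recursion of \<open>c_n\<close> says \<open>n\<^sup>2 c_n = (n - 1/2)\<^sup>2 c_{n-1}\<close>; this closed form of the flux coefficients is
  the hypergeometric equation read off coefficientwise.
\<close>

lemma flux_coeff_Suc: "flux_coeff (Suc n) = hyp_coeff n / (4 * real (Suc n))"
proof -
  define m where "m = real n"
  have "a * ((2 * a - 1) / (2 * a))\<^sup>2 - (a - 1) = 1 / (4 * a)" if "a > 0" for a :: real
    using that by (simp add: power_divide power2_eq_square divide_simps) (simp add: algebra_simps)
  from this[of "m + 1"] have "(m + 1) * ((2 * m + 1) / (2 * m + 2))\<^sup>2 - m = 1 / (4 * (m + 1))"
    by (simp add: m_def add_ac)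
  then have "hyp_coeff n * ((m + 1) * ((2 * m + 1) / (2 * m + 2))\<^sup>2 - m)
      = hyp_coeff n * (1 / (4 * (m + 1)))" by simp
  then show ?thesis
    by (simp add: flux_coeff_def m_def right_diff_distrib mult_ac add_ac)
qed

lemma flux_coeff_nonneg: "flux_coeff n \<ge> 0"
  by (cases n) (auto simp: flux_coeff_Suc less_imp_le[OF hyp_coeff_pos])

lemma flux_coeff_le_1: "flux_coeff n \<le> 1"
proof (cases n)
  case (Suc m)
  have "hyp_coeff m / (4 * real (Suc m)) \<le> 1"
    using hyp_coeff_le_1[of m] by (simp add: field_simps)
  then show ?thesis by (simp add: Suc flux_coeff_Suc)
qed auto

lemma summable_bounded_coeff:
  fixes a :: "nat \<Rightarrow> real"
  assumes "\<And>n. \<bar>a n\<bar> \<le> 1" "\<bar>t\<bar> < 1"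
  shows "summable (\<lambda>n. a n * t ^ n)"
proof (rule summable_comparison_test')
  show "summable (\<lambda>n. \<bar>t\<bar> ^ n)" using assms(2) by (simp add: summable_geometric)
  show "norm (a n * t ^ n) \<le> \<bar>t\<bar> ^ n" for n
    using mult_right_mono[OF assms(1)[of n], of "\<bar>t\<bar> ^ n"] by (simp add: abs_mult power_abs)
qed

lemma has_derivative_bounded_coeff:
  fixes a :: "nat \<Rightarrow> real"
  assumes "\<And>n. \<bar>a n\<bar> \<le> 1" "\<bar>t\<bar> < 1"
  shows "((\<lambda>t. \<Sum>n. a n * t ^ n) has_real_derivative (\<Sum>n. diffs a n * t ^ n)) (at t)"
proof -
  obtain K where K: "\<bar>t\<bar> < K" "K < 1" using dense[OF assms(2)] by auto
  show ?thesis
    by (rule termdiffs_strong[of a K])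
      (use K summable_bounded_coeff[of a K] assms in auto)
qed

lemma abs_hyp_coeff_le_1: "\<bar>hyp_coeff n\<bar> \<le> 1"
  using hyp_coeff_pos[of n] hyp_coeff_le_1[of n] by simp

lemma abs_flux_coeff_le_1: "\<bar>flux_coeff n\<bar> \<le> 1"
  using flux_coeff_nonneg[of n] flux_coeff_le_1[of n] by simp

lemma hypF_0: "hypF 0 = 1"
  by (simp add: hypF_def)

lemma hypG_0: "hypG 0 = 0"
  by (simp add: hypG_def)

lemma hypF_pos:
  assumes "0 \<le> t" "t < 1" shows "hypF t > 0"
  unfolding hypF_def
  by (rule suminf_pos2[where i = 0])
    (use assms less_imp_le[OF hyp_coeff_pos] in
      \<open>auto intro!: summable_bounded_coeff abs_hyp_coeff_le_1\<close>)

lemma DERIV_hypG: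
  assumes "\<bar>t\<bar> < 1"
  shows "(hypG has_real_derivative hypF t / 4) (at t)"
proof -
  have "diffs flux_coeff n * t ^ n = hyp_coeff n * t ^ n / 4" for n
    by (simp add: diffs_def flux_coeff_Suc del: of_nat_Suc)
  then have "(\<Sum>n. diffs flux_coeff n * t ^ n) = (\<Sum>n. hyp_coeff n * t ^ n / 4)"
    by (simp only:)
  also have "\<dots> = hypF t / 4"
    unfolding hypF_def
    by (rule suminf_divide) (intro summable_bounded_coeff abs_hyp_coeff_le_1 assms)
  finally have "(\<Sum>n. diffs flux_coeff n * t ^ n) = hypF t / 4" .
  with has_derivative_bounded_coeff[of flux_coeff, OF abs_flux_coeff_le_1 assms] show ?thesis
    by (simp only: hypG_def[abs_def])
qed

lemma hypF_diffs:
  assumes "\<bar>t\<bar> < 1"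
  shows "t * (1 - t) * (\<Sum>n. diffs hyp_coeff n * t ^ n) = hypG t"
proof -
  have "summable (\<lambda>n. diffs hyp_coeff n * t ^ n)"
    by (rule termdiff_converges[of _ 1])
      (use assms in \<open>auto intro!: summable_bounded_coeff abs_hyp_coeff_le_1\<close>)
  then have s: "(\<lambda>n. diffs hyp_coeff n * t ^ n) sums (\<Sum>n. diffs hyp_coeff n * t ^ n)" (is "_ sums ?D")
    by (rule summable_sums)
  have "(\<lambda>n. real (Suc n) * hyp_coeff (Suc n) * t ^ Suc n) sums (t * ?D)"
    using sums_mult[OF s, of t] by (simp add: diffs_def mult_ac)
  then have s1: "(\<lambda>n. real n * hyp_coeff n * t ^ n) sums (t * ?D)"
    using sums_Suc_iff[of "\<lambda>n. real n * hyp_coeff n * t ^ n" "t * ?D"] by simp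
  have "(\<lambda>n. real (Suc n - 1) * hyp_coeff (Suc n - 1) * t ^ Suc n) sums (t * (t * ?D))"
    using sums_mult[OF s1, of t] by (simp add: mult_ac)
  then have s2: "(\<lambda>n. real (n - 1) * hyp_coeff (n - 1) * t ^ n) sums (t * (t * ?D))"
    using sums_Suc_iff[of "\<lambda>n. real (n - 1) * hyp_coeff (n - 1) * t ^ n" "t * (t * ?D)"] by simp
  have "(\<lambda>n. flux_coeff n * t ^ n) sums (t * ?D - t * (t * ?D))"
    using sums_diff[OF s1 s2] by (simp add: flux_coeff_def algebra_simps)
  then show ?thesis by (simp add: hypG_def sums_iff algebra_simps)
qed

lemma DERIV_hypF:
  assumes "0 < t" "t < 1"
  shows "(hypF has_real_derivative hypG t / (t * (1 - t))) (at t)"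
proof -
  have "hypG t / (t * (1 - t)) = (\<Sum>n. diffs hyp_coeff n * t ^ n)"
    using hypF_diffs[of t, symmetric] assms by simp
  then show ?thesis
    using has_derivative_bounded_coeff[of hyp_coeff, OF abs_hyp_coeff_le_1, of t] assms
    by (simp add: hypF_def[abs_def])
qed

lemma continuous_on_hypF: "continuous_on {0..<1} hypF"
proof (rule DERIV_continuous_on)
  fix t :: real assume "t \<in> {0..<1}"
  then show "(hypF has_real_derivative (\<Sum>n. diffs hyp_coeff n * t ^ n)) (at t within {0..<1})"
    using has_derivative_bounded_coeff[of hyp_coeff, OF abs_hyp_coeff_le_1, of t]
    by (auto simp: hypF_def[abs_def] intro: has_field_derivative_at_within)
qed

lemma continuous_on_hypG: "continuous_on {0..<1} hypG"
  by (rule DERIV_continuous_on[OF has_field_derivative_at_within[OF DERIV_hypG]]) auto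

lemma continuous_on_powser_closed:
  fixes a :: "nat \<Rightarrow> real"
  assumes "summable (\<lambda>n. \<bar>a n\<bar>)"
  shows "continuous_on {0..1} (\<lambda>t. \<Sum>n. a n * t ^ n)"
proof (rule uniform_limit_theorem)
  show "uniform_limit {0..1} (\<lambda>N t. \<Sum>n<N. a n * t ^ n) (\<lambda>t. \<Sum>n. a n * t ^ n) sequentially"
  proof (rule Weierstrass_m_test[OF _ assms])
    fix n and t :: real assume "t \<in> {0..1}"
    then have "\<bar>a n\<bar> * \<bar>t ^ n\<bar> \<le> \<bar>a n\<bar> * 1"
      by (intro mult_left_mono) (auto intro!: power_le_one simp: power_abs)
    then show "norm (a n * t ^ n) \<le> \<bar>a n\<bar>" by (simp add: abs_mult)
  qed
qed (auto intro!: always_eventually continuous_intros)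

text \<open>
  This is where \<open>pi\<close> enters: \<open>(2n + 1) c_n\<close> is the reciprocal of the partial Wallis product.
\<close>

lemma hyp_coeff_wallis: "(\<lambda>n. real n * hyp_coeff n) \<longlonglongrightarrow> 1 / pi"
proof -
  define P where "P = (\<lambda>n. \<Prod>k=1..n. (4 * real k ^ 2) / (4 * real k ^ 2 - 1))"
  have prod: "P n * (hyp_coeff n * (2 * real n + 1)) = 1" for n
  proof (induction n)
    case (Suc n)
    define m where "m = real n"
    have m: "m \<ge> 0" by (simp add: m_def)
    have "4 * (m + 1)\<^sup>2 - 1 = (2 * m + 1) * (2 * m + 3)"
      by (simp add: power2_eq_square algebra_simps)
    moreover have "4 * (m + 1)\<^sup>2 = (2 * m + 2)\<^sup>2" by (simp add: power2_eq_square algebra_simps)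
    ultimately have ratio: "4 * (m + 1)\<^sup>2 / (4 * (m + 1)\<^sup>2 - 1) * (((2 * m + 1) / (2 * m + 2))\<^sup>2 * (2 * m + 3))
       = 2 * m + 1"
      using m by (simp add: power_divide divide_simps) (simp add: power2_eq_square algebra_simps)
    have "P (Suc n) * (hyp_coeff (Suc n) * (2 * real (Suc n) + 1))
        = P n * hyp_coeff n * (4 * (m + 1)\<^sup>2 / (4 * (m + 1)\<^sup>2 - 1) *
            (((2 * m + 1) / (2 * m + 2))\<^sup>2 * (2 * m + 3)))"
      by (simp add: P_def m_def add_ac mult_ac)
    also have "\<dots> = 1" unfolding ratio using Suc by (simp add: m_def mult_ac)
    finally show ?case .
  qed (auto simp: P_def)
  have lim: "(\<lambda>n. 1 / P n) \<longlonglongrightarrow> 1 / (pi / 2)"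
    unfolding P_def by (intro tendsto_intros wallis) auto
  have eq: "1 / P n = hyp_coeff n * (2 * real n + 1)" for n
    using prod[of n] by (metis mult_zero_left nonzero_eq_divide_eq mult.commute zero_neq_one)
  have "(\<lambda>n. hyp_coeff n * (2 * real n + 1)) \<longlonglongrightarrow> 1 / (pi / 2)"
    using lim by (simp only: eq)
  moreover have "(\<lambda>n. real n / (2 * real n + 1)) \<longlonglongrightarrow> 1 / 2"
    by real_asymp
  ultimately have "(\<lambda>n. (hyp_coeff n * (2 * real n + 1)) * (real n / (2 * real n + 1))) \<longlonglongrightarrow> 1 / (pi / 2) * (1 / 2)"
    by (rule tendsto_mult)
  moreover have "(hyp_coeff n * (2 * real n + 1)) * (real n / (2 * real n + 1)) = real n * hyp_coeff n" for n
    by (simp add: divide_simps)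
  ultimately show ?thesis by (simp add: mult.commute)
qed

lemma flux_coeff_sums: "flux_coeff sums (1 / pi)"
proof -
  have "(\<Sum>n<Suc N. flux_coeff n) = real N * hyp_coeff N" for N
    by (induction N) (simp_all add: flux_coeff_def)
  then have "(\<lambda>N. \<Sum>n<Suc N. flux_coeff n) \<longlonglongrightarrow> 1 / pi"
    using hyp_coeff_wallis by simp
  then show ?thesis
    unfolding sums_def by (rule LIMSEQ_imp_Suc)
qed

lemma hyp_coeff_tendsto_0: "hyp_coeff \<longlonglongrightarrow> 0"
proof -
  have "(\<lambda>n. real n * hyp_coeff n * (1 / real n)) \<longlonglongrightarrow> 1 / pi * 0"
    by (intro tendsto_mult hyp_coeff_wallis lim_1_over_n)
  moreover have "\<forall>\<^sub>F n in sequentially. real n * hyp_coeff n * (1 / real n) = hyp_coeff n"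
    using eventually_gt_at_top[of 0] by eventually_elim simp
  ultimately show ?thesis
    using tendsto_cong by fastforce
qed

text \<open>
  The coefficients of \<open>(1 - t) F(t)\<close>. Near \<open>t = 1\<close> the function \<open>F\<close> has a logarithmic singularity;
  since this damped series converges absolutely at \<open>t = 1\<close> with sum \<open>0\<close>, the singularity is too weak to
  contribute to the limit in the Legendre relation.
\<close>

definition damped_coeff :: "nat \<Rightarrow> real" where
  "damped_coeff n = hyp_coeff n - (if n = 0 then 0 else hyp_coeff (n - 1))"

lemma damped_coeff_sums: "damped_coeff sums 0"
proof -
  have "(\<Sum>n<Suc N. damped_coeff n) = hyp_coeff N" for N
    by (induction N) (simp_all add: damped_coeff_def del: hyp_coeff.simps(2))
  then have "(\<lambda>N. \<Sum>n<Suc N. damped_coeff n) \<longlonglongrightarrow> 0"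
    using hyp_coeff_tendsto_0 by simp
  then show ?thesis
    unfolding sums_def by (rule LIMSEQ_imp_Suc)
qed

lemma damped_coeff_abs_summable: "summable (\<lambda>n. \<bar>damped_coeff n\<bar>)"
proof -
  have "summable (\<lambda>n. - damped_coeff (Suc n))"
    using damped_coeff_sums by (intro summable_minus) (simp add: summable_Suc_iff sums_iff)
  moreover have "- damped_coeff (Suc n) = \<bar>damped_coeff (Suc n)\<bar>" for n
    using hyp_coeff_decreasing[of n] by (simp add: damped_coeff_def del: hyp_coeff.simps(2))
  ultimately have "summable (\<lambda>n. \<bar>damped_coeff (Suc n)\<bar>)" by simp
  then show ?thesis using summable_Suc_iff by blast
qed

lemma damped_hypF:
  assumes "\<bar>t\<bar> < 1"
  shows "(\<Sum>n. damped_coeff n * t ^ n) = (1 - t) * hypF t"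
proof -
  have s: "(\<lambda>n. hyp_coeff n * t ^ n) sums hypF t"
    unfolding hypF_def by (intro summable_sums summable_bounded_coeff abs_hyp_coeff_le_1 assms)
  have "(\<lambda>n. (if Suc n = 0 then 0 else hyp_coeff (Suc n - 1)) * t ^ Suc n) sums (t * hypF t)"
    using sums_mult[OF s, of t] by (simp add: mult_ac)
  then have "(\<lambda>n. (if n = 0 then 0 else hyp_coeff (n - 1)) * t ^ n) sums (t * hypF t)"
    using sums_Suc_iff[of "\<lambda>n. (if n = 0 then 0 else hyp_coeff (n - 1)) * t ^ n" "t * hypF t"] by simp
  from sums_diff[OF s this] show ?thesis
    by (simp add: damped_coeff_def sums_iff algebra_simps)
qed

text \<open>
  The left side is the Wronskian of the solutions \<open>F(t)\<close> and \<open>F(1 - t)\<close>, hence constant. As \<open>t\<close> tends to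
  \<open>0\<close> its first term tends to the flux at \<open>1\<close>, which is \<open>1/pi\<close>, and its second term vanishes.
\<close>

lemma hypF_legendre:
  assumes "0 < t" "t < 1"
  shows "hypF t * hypG (1 - t) + hypF (1 - t) * hypG t = 1 / pi"
proof -
  define W where "W = (\<lambda>t. hypF t * hypG (1 - t) + hypF (1 - t) * hypG t)"
  have W': "(W has_real_derivative 0) (at x)" if "0 < x" "x < 1" for x
  proof -
    have F: "((\<lambda>x. hypF (1 - x)) has_real_derivative (- (hypG (1 - x) / ((1 - x) * x)))) (at x)"
      by (rule DERIV_cong[OF DERIV_chain2[of hypF _ "\<lambda>x. 1 - x" _ "-1"]])
       (use that DERIV_hypF[of "1 - x"] in \<open>auto intro!: derivative_eq_intros\<close>)
    have G: "((\<lambda>x. hypG (1 - x)) has_real_derivative (- (hypF (1 - x) / 4))) (at x)"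
      by (rule DERIV_cong[OF DERIV_chain2[of hypG _ "\<lambda>x. 1 - x" _ "-1"]])
       (use that in \<open>auto intro!: derivative_eq_intros DERIV_hypG\<close>)
    have G': "(hypG has_real_derivative hypF x / 4) (at x)"
      using that by (intro DERIV_hypG) auto
    show ?thesis unfolding W_def
      by (rule DERIV_cong[OF DERIV_add[OF DERIV_mult[OF DERIV_hypF[OF that] G] DERIV_mult[OF F G']]])
        (use that in \<open>simp add: mult.commute\<close>)
  qed
  \<comment> \<open>The same function with the factors regrouped so that each one is continuous at 0.\<close>
  define V where "V = (\<lambda>t. hypF t * (\<Sum>n. flux_coeff n * (1 - t) ^ n)
     + (\<Sum>n. damped_coeff n * (1 - t) ^ n) * ((1 - t) * (\<Sum>n. diffs hyp_coeff n * t ^ n)))"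
  have VW: "V x = W x" if "0 < x" "x < 1" for x
  proof -
    have "hypG x = x * (1 - x) * (\<Sum>n. diffs hyp_coeff n * x ^ n)"
      using hypF_diffs[of x] that by simp
    moreover have "(\<Sum>n. damped_coeff n * (1 - x) ^ n) = x * hypF (1 - x)"
      using damped_hypF[of "1 - x"] that by simp
    ultimately show ?thesis
      by (simp only: V_def W_def hypG_def[of "1 - x"] mult_ac)
  qed
  have D: "continuous_on {0..<1} (\<lambda>t. \<Sum>n. diffs hyp_coeff n * t ^ n)"
    unfolding continuous_on_eq_continuous_within
  proof (rule ballI, rule continuous_at_imp_continuous_at_within)
    fix x :: real assume x: "x \<in> {0..<1}"
    then obtain K where K: "x < K" "K < 1" using dense[of x 1] by auto
    have "summable (\<lambda>n. diffs hyp_coeff n * K ^ n)"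
    proof (rule termdiff_converges[of _ 1])
      show "norm K < 1" using x K by simp
      show "summable (\<lambda>n. hyp_coeff n * y ^ n)" if "norm y < 1" for y
        using that by (intro summable_bounded_coeff abs_hyp_coeff_le_1) simp
    qed
    then show "isCont (\<lambda>t. \<Sum>n. diffs hyp_coeff n * t ^ n) x"
      by (rule isCont_powser) (use x K in auto)
  qed
  have flip: "continuous_on {0..t} (\<lambda>t. \<Sum>n. a n * (1 - t) ^ n)" if "summable (\<lambda>n. \<bar>a n\<bar>)" for a
    by (rule continuous_on_compose2[OF continuous_on_powser_closed[OF that]])
      (use assms in \<open>auto intro!: continuous_intros\<close>)
  have "continuous_on {0..t} V" unfolding V_def
    by (intro continuous_intros flip damped_coeff_abs_summable
        continuous_on_subset[OF continuous_on_hypF] continuous_on_subset[OF D])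
      (use assms flux_coeff_sums flux_coeff_nonneg in \<open>auto simp: sums_iff\<close>)
  moreover have "(V has_real_derivative 0) (at x)" if "0 < x" "x < t" for x
    by (rule DERIV_cong_ev[THEN iffD1, OF refl _ refl W'])
      (use that assms VW in \<open>auto simp: eventually_at_filter intro!: eventually_mono[OF eventually_nhds_in_open[of "{0<..<1}" x]]\<close>)
  ultimately have "V t = V 0"
    using DERIV_isconst_end[of 0 t V] assms by auto
  also have "V 0 = 1 / pi"
    using flux_coeff_sums damped_coeff_sums by (simp add: V_def hypF_0 sums_iff)
  finally show ?thesis using VW assms by (simp add: W_def)
qed

section \<open>Pull-backs of the hypergeometric equation and their symmetric squares\<close>

text \<open>
  Throughout, \<open>D = h d/dx\<close> for a coefficient \<open>h\<close> that vanishes at \<open>0\<close>. If \<open>D lam = g lam (1 - lam)\<close>, the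
  Liouville normal form of the pull-back of the hypergeometric equation along \<open>lam\<close> has the solution
  \<open>y = F(lam) / sqrt g\<close>; \<open>pull_v\<close> is \<open>D y\<close>.
\<close>

definition pull_y :: "(real \<Rightarrow> real) \<Rightarrow> (real \<Rightarrow> real) \<Rightarrow> real \<Rightarrow> real" where
  "pull_y g lam x = hypF (lam x) / sqrt (g x)"

definition pull_v :: "(real \<Rightarrow> real) \<Rightarrow> (real \<Rightarrow> real) \<Rightarrow> (real \<Rightarrow> real) \<Rightarrow> real \<Rightarrow> real" where
  "pull_v g dg lam x = sqrt (g x) * hypG (lam x) - hypF (lam x) * dg x / (2 * g x * sqrt (g x))"

text \<open>
  The normal form has no first-order term, so the pull-back solves \<open>D (D y) = R y\<close> for a potential \<open>R\<close>
  determined by \<open>g\<close> and \<open>lam\<close>; the hypothesis on \<open>R\<close> is that determination with denominators cleared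
  (\<open>dg\<close> and \<open>ddg\<close> are \<open>D g\<close> and \<open>D (D g)\<close>). Two different pairs \<open>(lam, g)\<close> with the same potential thus give solutions
  of one and the same equation; all transformation formulas below arise in this way.
\<close>

lemma pull_y_v_DERIV:
  assumes lam: "(lam has_real_derivative g x * (lam x * (1 - lam x)) / h) (at x)"
    and g: "(g has_real_derivative dg x / h) (at x)"
    and dg: "(dg has_real_derivative ddg / h) (at x)"
    and pos: "g x > 0" "0 < lam x" "lam x < 1" and h: "h > 0"
    and R: "4 * R * (g x)\<^sup>2 = - 2 * g x * ddg + 3 * (dg x)\<^sup>2 + (g x) ^ 4 * (lam x * (1 - lam x))"
  shows "(pull_y g lam has_real_derivative pull_v g dg lam x / h) (at x)"
    and "(pull_v g dg lam has_real_derivative R * pull_y g lam x / h) (at x)"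
proof -
  define s where "s = sqrt (g x)"
  have s: "s > 0" "g x = s\<^sup>2" using pos by (auto simp: s_def)
  have ds: "((\<lambda>x. sqrt (g x)) has_real_derivative dg x / (2 * s * h)) (at x)"
    by (rule DERIV_cong[OF DERIV_chain2[where f = sqrt and g = g, OF DERIV_real_sqrt g]])
      (use pos in \<open>simp_all add: s_def field_split_simps\<close>)
  have dF: "((\<lambda>x. hypF (lam x)) has_real_derivative g x * hypG (lam x) / h) (at x)"
    by (rule DERIV_cong[OF DERIV_chain2[where f = hypF and g = lam, OF DERIV_hypF lam]]) (use pos in simp_all)
  have dG: "((\<lambda>x. hypG (lam x)) has_real_derivative hypF (lam x) / 4 * (g x * (lam x * (1 - lam x)) / h)) (at x)"
    by (rule DERIV_chain2[where f = hypG and g = lam, OF DERIV_hypG lam]) (use pos in auto)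
  show "(pull_y g lam has_real_derivative pull_v g dg lam x / h) (at x)"
    unfolding pull_y_def[abs_def]
    by (rule DERIV_cong[OF DERIV_divide[OF dF ds]])
      (use s h in \<open>auto simp: pull_v_def field_simps power2_eq_square s_def[symmetric]\<close>)
  have dgs: "((\<lambda>x. 2 * g x * sqrt (g x)) has_real_derivative 3 * s * dg x / h) (at x)"
    by (rule DERIV_cong[OF DERIV_mult[OF DERIV_cmult[OF g] ds]])
      (use s h in \<open>auto simp: field_simps power2_eq_square s_def[symmetric]\<close>)
  define L F G d where "L = lam x * (1 - lam x)" "F = hypF (lam x)" "G = hypG (lam x)" "d = dg x"
  note abbr = this
  have R': "4 * R * s ^ 4 = - 2 * s\<^sup>2 * ddg + 3 * d\<^sup>2 + s ^ 8 * L"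
    using R unfolding s(2) abbr by (simp flip: power_mult)
  show "(pull_v g dg lam has_real_derivative R * pull_y g lam x / h) (at x)"
    unfolding pull_v_def[abs_def]
  proof (rule DERIV_cong[OF DERIV_diff[OF DERIV_mult[OF ds dG] DERIV_divide[OF DERIV_mult[OF dF dg] dgs]]])
    show "2 * g x * sqrt (g x) \<noteq> 0" using pos by simp
    have "s * (F / 4 * (s\<^sup>2 * L / h)) + d / (2 * s * h) * G
        - ((F * (ddg / h) + s\<^sup>2 * G / h * d) * (2 * s\<^sup>2 * s) - F * d * (3 * s * d / h)) / ((2 * s\<^sup>2 * s) * (2 * s\<^sup>2 * s))
        = F / (4 * s ^ 5 * h) * (- 2 * s\<^sup>2 * ddg + 3 * d\<^sup>2 + s ^ 8 * L)"
      using s(1) h by (simp add: divide_simps) (simp add: algebra_simps eval_nat_numeral)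
    also have "\<dots> = R * F / (s * h)"
      unfolding R'[symmetric] using s(1) h by (simp add: divide_simps eval_nat_numeral)
    finally show "dg x / (2 * s * h) * hypG (lam x) + hypF (lam x) / 4 * (g x * (lam x * (1 - lam x)) / h) * sqrt (g x) -
      ((g x * hypG (lam x) / h * dg x + ddg / h * hypF (lam x)) * (2 * g x * sqrt (g x)) -
       hypF (lam x) * dg x * (3 * s * dg x / h)) / (2 * g x * sqrt (g x) * (2 * g x * sqrt (g x))) =
      R * pull_y g lam x / h"
      unfolding pull_y_def s_def[symmetric] unfolding s(2) abbr[symmetric] 
      by (simp add: mult_ac add_ac)
  qed
qed

lemma const_from_left_end:
  fixes f :: "real \<Rightarrow> real"
  assumes "continuous_on {0..<r} f" "\<And>x. 0 < x \<Longrightarrow> x < r \<Longrightarrow> (f has_real_derivative 0) (at x)"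
    and "0 \<le> x" "x < r"
  shows "f x = f 0"
proof (cases "x = 0")
  case False
  show ?thesis
    by (rule DERIV_isconst_end[of 0 x f])
      (use assms False in \<open>auto intro: continuous_on_subset\<close>)
qed auto

text \<open>
  The Wronskian \<open>y D z - z D y\<close> is constant, and it vanishes at \<open>0\<close> because \<open>D y\<close> and \<open>D z\<close> do. This is the
  statement that the solution without logarithm at the singular point \<open>0\<close> is unique up to a factor.
\<close>

lemma proportional_solutions:
  fixes y v z u R h :: "real \<Rightarrow> real"
  assumes h: "\<And>x. 0 < x \<Longrightarrow> x < r \<Longrightarrow> h x > 0"
    and y: "\<And>x. 0 < x \<Longrightarrow> x < r \<Longrightarrow> (y has_real_derivative v x / h x) (at x)"
    and v: "\<And>x. 0 < x \<Longrightarrow> x < r \<Longrightarrow> (v has_real_derivative R x * y x / h x) (at x)"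
    and z: "\<And>x. 0 < x \<Longrightarrow> x < r \<Longrightarrow> (z has_real_derivative u x / h x) (at x)"
    and u: "\<And>x. 0 < x \<Longrightarrow> x < r \<Longrightarrow> (u has_real_derivative R x * z x / h x) (at x)"
    and cont: "continuous_on {0..<r} y" "continuous_on {0..<r} v"
      "continuous_on {0..<r} z" "continuous_on {0..<r} u"
    and init: "v 0 = 0" "u 0 = 0"
    and pos: "\<And>x. 0 \<le> x \<Longrightarrow> x < r \<Longrightarrow> y x > 0"
    and x: "0 \<le> x" "x < r"
  shows "z x / y x = z 0 / y 0"
proof -
  have W: "y x * u x - z x * v x = y 0 * u 0 - z 0 * v 0" if "0 \<le> x" "x < r" for x
  proof (rule const_from_left_end[OF _ _ that])
    fix x assume x: "0 < x" "x < r"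
    show "((\<lambda>x. y x * u x - z x * v x) has_real_derivative 0) (at x)"
      by (rule DERIV_cong[OF DERIV_diff[OF DERIV_mult[OF y[OF x] u[OF x]] DERIV_mult[OF z[OF x] v[OF x]]]])
        (use h[OF x] in \<open>simp add: field_simps\<close>)
  qed (intro continuous_intros cont)
  show ?thesis
  proof (rule const_from_left_end[OF _ _ x])
    show "continuous_on {0..<r} (\<lambda>x. z x / y x)"
      by (intro continuous_intros cont) (use pos in force)
    fix x assume x: "0 < x" "x < r"
    have "y x > 0" using pos x by simp
    then show "((\<lambda>x. z x / y x) has_real_derivative 0) (at x)"
      by (intro DERIV_cong[OF DERIV_divide[OF z[OF x] y[OF x]]])
        (use W[of x] init h[OF x] x in \<open>simp_all add: field_simps\<close>)
  qed
qed

text \<open>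
  The products of two solutions of \<open>D (D y) = R y\<close> are the solutions of
  \<open>D\<^sup>3 Z = 4 R D Z + 2 (D R) Z\<close>. Dividing by \<open>y\<^sup>2\<close> turns this equation into the vanishing of the threefold iterate of \<open>y\<^sup>2 D\<close> on
  \<open>Z / y\<^sup>2\<close>; the successive integration constants are \<open>0\<close> because \<open>D Z\<close> and \<open>D (D Z)\<close> vanish at the origin,
  so \<open>Z\<close> is a multiple of \<open>y\<^sup>2\<close>.
\<close>

lemma symmetric_square_solution:
  fixes y v Z Z1 Z2 R R1 h :: "real \<Rightarrow> real"
  assumes h: "\<And>x. 0 < x \<Longrightarrow> x < r \<Longrightarrow> h x > 0"
    and y: "\<And>x. 0 < x \<Longrightarrow> x < r \<Longrightarrow> (y has_real_derivative v x / h x) (at x)"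
    and v: "\<And>x. 0 < x \<Longrightarrow> x < r \<Longrightarrow> (v has_real_derivative R x * y x / h x) (at x)"
    and Z: "\<And>x. 0 < x \<Longrightarrow> x < r \<Longrightarrow> (Z has_real_derivative Z1 x / h x) (at x)"
    and Z1: "\<And>x. 0 < x \<Longrightarrow> x < r \<Longrightarrow> (Z1 has_real_derivative Z2 x / h x) (at x)"
    and Z2: "\<And>x. 0 < x \<Longrightarrow> x < r \<Longrightarrow>
        (Z2 has_real_derivative (4 * R x * Z1 x + 2 * R1 x * Z x) / h x) (at x)"
    and R: "\<And>x. 0 < x \<Longrightarrow> x < r \<Longrightarrow> (R has_real_derivative R1 x / h x) (at x)"
    and cont: "continuous_on {0..<r} y" "continuous_on {0..<r} v" "continuous_on {0..<r} Z"
      "continuous_on {0..<r} Z1" "continuous_on {0..<r} Z2" "continuous_on {0..<r} R"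
    and init: "v 0 = 0" "Z1 0 = 0" "Z2 0 = 0" "R 0 = 0"
    and pos: "\<And>x. 0 \<le> x \<Longrightarrow> x < r \<Longrightarrow> y x > 0"
    and x: "0 \<le> x" "x < r"
  shows "Z x / (y x)\<^sup>2 = Z 0 / (y 0)\<^sup>2"
proof -
  define U2 where "U2 = (\<lambda>x. (y x)\<^sup>2 * Z2 x - 2 * (y x * v x) * Z1 x + 2 * ((v x)\<^sup>2 - R x * (y x)\<^sup>2) * Z x)"
  have U2: "U2 x = U2 0" if "0 \<le> x" "x < r" for x
  proof (rule const_from_left_end[OF _ _ that])
    fix x assume x: "0 < x" "x < r"
    note d = y[OF x] v[OF x] Z[OF x] Z1[OF x] Z2[OF x] R[OF x]
    show "(U2 has_real_derivative 0) (at x)"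
      unfolding U2_def
      by (rule derivative_eq_intros d refl)+
        (use h[OF x] in \<open>simp add: field_simps power2_eq_square\<close>)
  qed (unfold U2_def, intro continuous_intros cont)
  have U2: "U2 x = 0" if "0 \<le> x" "x < r" for x
    using U2[OF that] init by (simp add: U2_def)
  define U1 where "U1 = (\<lambda>x. Z1 x - 2 * Z x * v x / y x)"
  have U1: "U1 x = U1 0" if "0 \<le> x" "x < r" for x
  proof (rule const_from_left_end[OF _ _ that])
    show "continuous_on {0..<r} U1" unfolding U1_def
      by (intro continuous_intros cont) (use pos in force)
    fix x assume x: "0 < x" "x < r"
    have yp: "y x > 0" using pos x by simp
    have "(U1 has_real_derivative U2 x / (h x * (y x)\<^sup>2)) (at x)"
      unfolding U1_def
      by (rule DERIV_cong[OF DERIV_diff[OF Z1[OF x] DERIV_divide[OF DERIV_mult[OF DERIV_cmult[OF Z[OF x]] v[OF x]] y[OF x]]]])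
        (use h[OF x] yp in \<open>simp_all add: U2_def divide_simps power2_eq_square, simp add: algebra_simps\<close>)
    then show "(U1 has_real_derivative 0) (at x)" using U2[of x] x by simp
  qed
  have U1: "U1 x = 0" if "0 \<le> x" "x < r" for x
    using U1[OF that] init by (simp add: U1_def)
  show ?thesis
  proof (rule const_from_left_end[OF _ _ x])
    show "continuous_on {0..<r} (\<lambda>x. Z x / (y x)\<^sup>2)"
      by (intro continuous_intros cont) (use pos in force)
    fix x assume x: "0 < x" "x < r"
    have yp: "y x > 0" using pos x by simp
    have "((\<lambda>x. Z x / (y x)\<^sup>2) has_real_derivative U1 x / (h x * (y x)\<^sup>2)) (at x)"
      by (rule DERIV_cong[OF DERIV_divide[OF Z[OF x] DERIV_power[OF y[OF x], of 2]]])
        (use h[OF x] yp in \<open>simp_all add: U1_def divide_simps power2_eq_square, simp add: algebra_simps\<close>)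
    then show "((\<lambda>x. Z x / (y x)\<^sup>2) has_real_derivative 0) (at x)" using U1[of x] x by simp
  qed
qed

section \<open>The sequence, its growth and the differential equation of its generating function\<close>

lemma sums_shift:
  fixes a :: "nat \<Rightarrow> real"
  assumes "a sums s"
  shows "(\<lambda>n. if n < j then 0 else a (n - j)) sums s"
  using assms sums_zero_iff_shift[of j "\<lambda>n. if n < j then 0 else a (n - j)" s] by simp

text \<open>
  The leading polynomial \<open>w\<close> of the recurrence, followed by its first and second images under
  \<open>theta = x d/dx\<close>; it factors as \<open>w = (1 + x)\<^sup>2 (1 - 8x - 2x\<^sup>2 - 8x\<^sup>3 + x\<^sup>4)\<close>.
\<close>

definition disc_poly :: "real \<Rightarrow> real" where
  "disc_poly x = 1 - 6 * x - 17 * x^2 - 20 * x^3 - 17 * x^4 - 6 * x^5 + x^6"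

definition disc_poly1 :: "real \<Rightarrow> real" where
  "disc_poly1 x = - 6 * x - 34 * x^2 - 60 * x^3 - 68 * x^4 - 30 * x^5 + 6 * x^6"

definition disc_poly2 :: "real \<Rightarrow> real" where
  "disc_poly2 x = - 6 * x - 68 * x^2 - 180 * x^3 - 272 * x^4 - 150 * x^5 + 36 * x^6"

text \<open>
  The potential \<open>R\<close> for which the recurrence is the symmetric square equation with
  \<open>D = sqrt w theta\<close>; the second polynomial is \<open>theta R\<close>.
\<close>

definition potential :: "real \<Rightarrow> real" where
  "potential x = x / 2 + 27 / 4 * x^2 + 14 * x^3 + 39 / 2 * x^4 + 19 / 2 * x^5 - 9 / 4 * x^6"

definition potential1 :: "real \<Rightarrow> real" where
  "potential1 x = x / 2 + 27 / 2 * x^2 + 42 * x^3 + 78 * x^4 + 95 / 2 * x^5 - 27 / 2 * x^6"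

locale level20_sequence =
  fixes A :: "nat \<Rightarrow> real"
  assumes init: "A 0 = 1" "A 1 = 1" "A 2 = 6" "A 3 = 30" "A 4 = 175" "A 5 = 1087"
    and rec: "\<And>n::nat. n \<ge> 6 \<Longrightarrow>
        (-54 + 54 * real n - 18 * real n ^ 2 + 2 * real n ^ 3) * A (n - 6)
      + (190 - 226 * real n + 90 * real n ^ 2 - 12 * real n ^ 3) * A (n - 5)
      + (312 - 428 * real n + 204 * real n ^ 2 - 34 * real n ^ 3) * A (n - 4)
      + (168 - 292 * real n + 180 * real n ^ 2 - 40 * real n ^ 3) * A (n - 3)
      + (54 - 122 * real n + 102 * real n ^ 2 - 34 * real n ^ 3) * A (n - 2)
      + (2 - 10 * real n + 18 * real n ^ 2 - 12 * real n ^ 3) * A (n - 1)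
      + 2 * real n ^ 3 * A n = 0"
begin

text \<open>
  Any base above \<open>8.36\<close> (the reciprocal of the smallest positive root of \<open>w\<close>) could be used asymptotically;
  with base \<open>10\<close> the triangle inequality in the recurrence suffices, as each coefficient is bounded by its leading term, and
  \<open>(7 - 4 sqrt 3) * 10 < 1\<close>.
\<close>

lemma growth: "\<bar>A n\<bar> \<le> 10 ^ n"
proof (induction n rule: less_induct)
  case (less n)
  show ?case
  proof (cases "n < 6")
    case True
    then consider "n = 0" | "n = 1" | "n = 2" | "n = 3" | "n = 4" | "n = 5" by linarith
    then show ?thesis by cases (auto simp: init[simplified])
  next
    case False
    define m where "m = n - 6"
    define s where "s = real m"
    have n: "n = m + 6" "real n = s + 6" using False by (auto simp: m_def s_def)
    have s: "s \<ge> 0" by (simp add: s_def)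
    note pos = s zero_le_power[OF s, of 2] zero_le_power[OF s, of 3]
    define c6 c5 c4 c3 c2 c1 where
      c: "c6 = -54 + 54 * real n - 18 * real n ^ 2 + 2 * real n ^ 3"
         "c5 = 190 - 226 * real n + 90 * real n ^ 2 - 12 * real n ^ 3"
         "c4 = 312 - 428 * real n + 204 * real n ^ 2 - 34 * real n ^ 3"
         "c3 = 168 - 292 * real n + 180 * real n ^ 2 - 40 * real n ^ 3"
         "c2 = 54 - 122 * real n + 102 * real n ^ 2 - 34 * real n ^ 3"
         "c1 = 2 - 10 * real n + 18 * real n ^ 2 - 12 * real n ^ 3"
    define N where "N = real n ^ 3"
    have N: "N > 0" unfolding N_def n(2) using s by simp
    have exp2: "(s + 6)\<^sup>2 = s\<^sup>2 + 12 * s + 36" and exp3: "(s + 6) ^ 3 = s ^ 3 + 18 * s\<^sup>2 + 108 * s + 216"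
      by (simp_all add: power2_eq_square power3_eq_cube algebra_simps)
    have cb: "\<bar>c6\<bar> \<le> 2 * N" "\<bar>c5\<bar> \<le> 12 * N" "\<bar>c4\<bar> \<le> 34 * N" "\<bar>c3\<bar> \<le> 40 * N" "\<bar>c2\<bar> \<le> 34 * N" "\<bar>c1\<bar> \<le> 12 * N"
      unfolding c N_def n(2) exp2 exp3 abs_le_iff using pos by (auto simp: algebra_simps)
    have b: "\<bar>c * A (n - k)\<bar> \<le> l * N * 10 ^ (n - k)" if "\<bar>c\<bar> \<le> l * N" "0 < k" for c l k
    proof -
      have "\<bar>A (n - k)\<bar> \<le> 10 ^ (n - k)"
        using False that by (intro less.IH) simp
      then show ?thesis
        unfolding abs_mult using that(1) by (intro mult_mono) simp_all
    qed
    have eq: "2 * N * A n = - (c6 * A (n - 6) + c5 * A (n - 5) + c4 * A (n - 4) + c3 * A (n - 3) + c2 * A (n - 2) + c1 * A (n - 1))"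
      using rec[of n] n(1) unfolding c N_def by (simp add: algebra_simps)
    have "2 * N * \<bar>A n\<bar> = \<bar>2 * N * A n\<bar>" using N by (simp add: abs_mult)
    also have "\<dots> \<le> 2 * N * 10 ^ (n - 6) + 12 * N * 10 ^ (n - 5) + 34 * N * 10 ^ (n - 4)
        + 40 * N * 10 ^ (n - 3) + 34 * N * 10 ^ (n - 2) + 12 * N * 10 ^ (n - 1)"
      unfolding eq abs_minus_cancel
      by (intro order_trans[OF abs_triangle_ineq] add_mono b cb) simp_all
    also have "\<dots> = 1583522 * N * 10 ^ m"
      unfolding n(1) by (simp add: power_add eval_nat_numeral)
    also have "\<dots> \<le> 2000000 * N * 10 ^ m" using N by simp
    also have "\<dots> = 2 * N * 10 ^ n" unfolding n(1) by (simp add: power_add)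
    finally show ?thesis using N by simp
  qed
qed

text \<open>
  For the generating function \<open>Z\<close> of the sequence this is \<open>theta\<^sup>k Z\<close>.
\<close>

definition genfun :: "nat \<Rightarrow> real \<Rightarrow> real" where
  "genfun k x = (\<Sum>n. real n ^ k * A n * x ^ n)"

lemma summable_genfun:
  assumes "\<bar>x\<bar> < 1 / 10"
  shows "summable (\<lambda>n. real n ^ k * A n * x ^ n)"
  using assms
proof (induction k arbitrary: x)
  case 0
  show ?case
  proof (rule summable_comparison_test')
    show "summable (\<lambda>n. (10 * \<bar>x\<bar>) ^ n)" using 0 by (intro summable_geometric) simp
    show "norm (real n ^ 0 * A n * x ^ n) \<le> (10 * \<bar>x\<bar>) ^ n" for n
      using mult_right_mono[OF growth[of n], of "\<bar>x\<bar> ^ n"]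
      by (simp add: abs_mult power_abs power_mult_distrib)
  qed
next
  case (Suc k)
  have "summable (\<lambda>n. diffs (\<lambda>n. real n ^ k * A n) n * x ^ n)"
    by (rule termdiff_converges[of x "1 / 10"]) (use Suc in auto)
  from summable_mult[OF this, of x] have "summable (\<lambda>n. real (Suc n) ^ Suc k * A (Suc n) * x ^ Suc n)"
    by (simp add: diffs_def mult_ac)
  then show ?case using summable_Suc_iff[of "\<lambda>n. real n ^ Suc k * A n * x ^ n"] by simp
qed

lemma sums_genfun:
  assumes "\<bar>x\<bar> < 1 / 10"
  shows "(\<lambda>n. real n ^ k * A n * x ^ n) sums genfun k x"
  unfolding genfun_def by (rule summable_sums[OF summable_genfun[OF assms]])

lemma genfun_at_0: "genfun k 0 = (if k = 0 then 1 else 0)"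
  by (simp add: genfun_def init)

lemma DERIV_genfun_diffs:
  assumes "\<bar>x\<bar> < 1 / 10"
  shows "(genfun k has_real_derivative (\<Sum>n. diffs (\<lambda>n. real n ^ k * A n) n * x ^ n)) (at x)"
proof -
  obtain K where K: "\<bar>x\<bar> < K" "K < 1 / 10" using dense[OF assms] by auto
  show ?thesis unfolding genfun_def[abs_def]
    by (rule termdiffs_strong[of _ K]) (use K summable_genfun[of K] in auto)
qed

lemma DERIV_genfun:
  assumes "\<bar>x\<bar> < 1 / 10" "x \<noteq> 0"
  shows "(genfun k has_real_derivative genfun (Suc k) x / x) (at x)"
proof -
  have "summable (\<lambda>n. diffs (\<lambda>n. real n ^ k * A n) n * x ^ n)" (is "summable ?d")
    by (rule termdiff_converges[of x "1 / 10"]) (use assms summable_genfun in auto)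
  from sums_mult[OF summable_sums[OF this], of x]
  have "(\<lambda>n. real (Suc n) ^ Suc k * A (Suc n) * x ^ Suc n) sums (x * suminf ?d)"
    by (simp add: diffs_def mult_ac)
  then have "(\<lambda>n. real n ^ Suc k * A n * x ^ n) sums (x * suminf ?d)"
    using sums_Suc_iff[of "\<lambda>n. real n ^ Suc k * A n * x ^ n" "x * suminf ?d"] by simp
  then have "genfun (Suc k) x = x * suminf ?d" unfolding genfun_def by (rule sums_unique[symmetric])
  then show ?thesis using DERIV_genfun_diffs[OF assms(1), of k] assms(2) by simp
qed

lemma continuous_on_genfun: "continuous_on {0..<1/10} (genfun k)"
  by (rule DERIV_continuous_on[OF has_field_derivative_at_within[OF DERIV_genfun_diffs]]) auto

definition coef :: "nat \<Rightarrow> real \<Rightarrow> real" where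
  "coef j n = [2 * n ^ 3,
     2 - 10 * n + 18 * n ^ 2 - 12 * n ^ 3,
     54 - 122 * n + 102 * n ^ 2 - 34 * n ^ 3,
     168 - 292 * n + 180 * n ^ 2 - 40 * n ^ 3,
     312 - 428 * n + 204 * n ^ 2 - 34 * n ^ 3,
     190 - 226 * n + 90 * n ^ 2 - 12 * n ^ 3,
     -54 + 54 * n - 18 * n ^ 2 + 2 * n ^ 3] ! j"

lemma coef_recurrence: "(\<Sum>j<7. if n < j then 0 else coef j (real n) * A (n - j)) = 0"
proof (cases "n < 6")
  case True
  then consider "n = 0" | "n = 1" | "n = 2" | "n = 3" | "n = 4" | "n = 5" by linarith
  moreover have "A (Suc 0) = 1" "A (Suc (Suc 0)) = 6" "A (Suc (Suc (Suc 0))) = 30"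
    "A (Suc (Suc (Suc (Suc 0)))) = 175" "A (Suc (Suc (Suc (Suc (Suc 0))))) = 1087"
    using init by (simp_all add: eval_nat_numeral)
  ultimately show ?thesis
    by cases (simp_all add: eval_nat_numeral coef_def init(1))
next
  case False
  then show ?thesis using rec[of n]
    by (simp add: eval_nat_numeral coef_def)
qed

text \<open>
  The recurrence, summed against \<open>x^n\<close>: after the shift \<open>n = m + j\<close> its \<open>j\<close>-th coefficient is
  \<open>w_j (m\<^sup>3 + 3/2 j m\<^sup>2 + 1/2 j\<^sup>2 m) - 4 r_j m - 2 j r_j\<close> up to a factor \<open>2\<close>, where \<open>w_j\<close> and \<open>r_j\<close> are the coefficients
  of \<open>w\<close> and \<open>R\<close>; this is the symmetric square equation.
\<close>

lemma genfun_ode: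
  assumes x: "\<bar>x\<bar> < 1 / 10"
  shows "disc_poly x * genfun 3 x + 3 / 2 * disc_poly1 x * genfun 2 x
     + (disc_poly2 x / 2 - 4 * potential x) * genfun 1 x - 2 * potential1 x * genfun 0 x = 0"
proof -
  have s: "(\<lambda>n. (if n < j then 0 else coef j (real n) * A (n - j)) * x ^ n)
     sums (x ^ j * (a * genfun 3 x + b * genfun 2 x + c * genfun 1 x + d * genfun 0 x))"
    if "\<And>m. coef j (m + real j) = a * m ^ 3 + b * m ^ 2 + c * m + d" for j a b c d
  proof -
    have "(\<lambda>m. x ^ j * (a * (real m ^ 3 * A m * x ^ m) + b * (real m ^ 2 * A m * x ^ m)
        + c * (real m ^ 1 * A m * x ^ m) + d * (real m ^ 0 * A m * x ^ m)))
       sums (x ^ j * (a * genfun 3 x + b * genfun 2 x + c * genfun 1 x + d * genfun 0 x))"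
      by (intro sums_mult sums_add sums_genfun x)
    moreover have "x ^ j * (a * (real m ^ 3 * A m * x ^ m) + b * (real m ^ 2 * A m * x ^ m)
        + c * (real m ^ 1 * A m * x ^ m) + d * (real m ^ 0 * A m * x ^ m))
      = coef j (real m + real j) * A m * (x ^ j * x ^ m)" for m
      unfolding that by (simp add: algebra_simps)
    ultimately have "(\<lambda>m. coef j (real m + real j) * A m * (x ^ j * x ^ m))
       sums (x ^ j * (a * genfun 3 x + b * genfun 2 x + c * genfun 1 x + d * genfun 0 x))" by (simp only:)
    from sums_shift[OF this, of j] show ?thesis
      by (rule sums_cong[THEN iffD1, rotated]) (auto simp flip: power_add)
  qed
  have c: "coef 0 (m + real 0) = 2 * m ^ 3 + 0 * m ^ 2 + 0 * m + 0"
    "coef 1 (m + real 1) = (-12) * m ^ 3 + (-18) * m ^ 2 + (-10) * m + (-2)"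
    "coef 2 (m + real 2) = (-34) * m ^ 3 + (-102) * m ^ 2 + (-122) * m + (-54)"
    "coef 3 (m + real 3) = (-40) * m ^ 3 + (-180) * m ^ 2 + (-292) * m + (-168)"
    "coef 4 (m + real 4) = (-34) * m ^ 3 + (-204) * m ^ 2 + (-428) * m + (-312)"
    "coef 5 (m + real 5) = (-12) * m ^ 3 + (-90) * m ^ 2 + (-226) * m + (-190)"
    "coef 6 (m + real 6) = 2 * m ^ 3 + 18 * m ^ 2 + 54 * m + 54" for m
    by (simp_all add: coef_def power2_eq_square power3_eq_cube) (simp_all add: algebra_simps)
  have sum7: "(\<Sum>j<7. f j) = f 0 + (f 1 + (f 2 + (f 3 + (f 4 + (f 5 + f 6)))))" for f :: "nat \<Rightarrow> real"
    by (simp add: eval_nat_numeral)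
  note sums_add[OF s[OF c(1)] sums_add[OF s[OF c(2)] sums_add[OF s[OF c(3)] sums_add[OF s[OF c(4)]
      sums_add[OF s[OF c(5)] sums_add[OF s[OF c(6)] s[OF c(7)]]]]]]]
  moreover have "(if n < 0 then 0 else coef 0 (real n) * A (n - 0)) * x ^ n
      + ((if n < 1 then 0 else coef 1 (real n) * A (n - 1)) * x ^ n
      + ((if n < 2 then 0 else coef 2 (real n) * A (n - 2)) * x ^ n
      + ((if n < 3 then 0 else coef 3 (real n) * A (n - 3)) * x ^ n
      + ((if n < 4 then 0 else coef 4 (real n) * A (n - 4)) * x ^ n
      + ((if n < 5 then 0 else coef 5 (real n) * A (n - 5)) * x ^ n
      + (if n < 6 then 0 else coef 6 (real n) * A (n - 6)) * x ^ n)))))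
     = (\<Sum>j<7. if n < j then 0 else coef j (real n) * A (n - j)) * x ^ n" for n
    unfolding distrib_right[symmetric] sum7 by (rule refl)
  ultimately have "(\<lambda>n. 0 * x ^ n) sums
     (x ^ 0 * (2 * genfun 3 x + 0 * genfun 2 x + 0 * genfun 1 x + 0 * genfun 0 x)
    + (x ^ 1 * ((-12) * genfun 3 x + (-18) * genfun 2 x + (-10) * genfun 1 x + (-2) * genfun 0 x)
    + (x ^ 2 * ((-34) * genfun 3 x + (-102) * genfun 2 x + (-122) * genfun 1 x + (-54) * genfun 0 x)
    + (x ^ 3 * ((-40) * genfun 3 x + (-180) * genfun 2 x + (-292) * genfun 1 x + (-168) * genfun 0 x)
    + (x ^ 4 * ((-34) * genfun 3 x + (-204) * genfun 2 x + (-428) * genfun 1 x + (-312) * genfun 0 x)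
    + (x ^ 5 * ((-12) * genfun 3 x + (-90) * genfun 2 x + (-226) * genfun 1 x + (-190) * genfun 0 x)
    + x ^ 6 * (2 * genfun 3 x + 18 * genfun 2 x + 54 * genfun 1 x + 54 * genfun 0 x)))))))"
    unfolding coef_recurrence by (simp only:)
  then have "(x ^ 0 * (2 * genfun 3 x + 0 * genfun 2 x + 0 * genfun 1 x + 0 * genfun 0 x)
    + (x ^ 1 * ((-12) * genfun 3 x + (-18) * genfun 2 x + (-10) * genfun 1 x + (-2) * genfun 0 x)
    + (x ^ 2 * ((-34) * genfun 3 x + (-102) * genfun 2 x + (-122) * genfun 1 x + (-54) * genfun 0 x)
    + (x ^ 3 * ((-40) * genfun 3 x + (-180) * genfun 2 x + (-292) * genfun 1 x + (-168) * genfun 0 x)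
    + (x ^ 4 * ((-34) * genfun 3 x + (-204) * genfun 2 x + (-428) * genfun 1 x + (-312) * genfun 0 x)
    + (x ^ 5 * ((-12) * genfun 3 x + (-90) * genfun 2 x + (-226) * genfun 1 x + (-190) * genfun 0 x)
    + x ^ 6 * (2 * genfun 3 x + 18 * genfun 2 x + 54 * genfun 1 x + 54 * genfun 0 x))))))) = 0"
    using sums_unique2[OF _ sums_zero] by simp
  then show ?thesis
    unfolding disc_poly_def disc_poly1_def disc_poly2_def potential_def potential1_def
    by (simp add: algebra_simps add_divide_distrib diff_divide_distrib)
qed

end

section \<open>Algebra of the level 20 parametrization\<close>

text \<open>
  The curve \<open>s\<^sup>2 = quart x\<close> is the modular curve \<open>X_0(20)\<close>, and its involution \<open>s \<mapsto> - s\<close> is the Fricke involution. On it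
  \<open>lam20\<close> is the function \<open>theta_2(q)^4 / theta_3(q)^4\<close>, the elliptic lambda function at \<open>2 tau\<close>; its
  conjugate is \<open>1\<close> minus the lambda function at \<open>10 tau\<close>. It was found from its divisor, which is supported on the
  cusps, where \<open>x\<close> is \<open>0\<close>, \<open>\<infinity>\<close> or \<open>-1\<close>. The function \<open>g20\<close> is \<open>theta_3^4\<close> over the
  generating function \<open>Z\<close>, and \<open>dg20\<close>, \<open>ddg20\<close> are its images under \<open>D = x (1 + x) s d/dx\<close>.
\<close>

definition quart :: "real \<Rightarrow> real" where
  "quart x = 1 - 8 * x - 2 * x^2 - 8 * x^3 + x^4"

definition lam20 :: "real \<Rightarrow> real \<Rightarrow> real" where
  "lam20 s x = ((1 + x)^5 + 16 * x * (1 - x) * (1 + x^2) - (1 - x) * (1 - 6 * x + x^2) * s) / (2 * (1 + x)^5)"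

definition g20 :: "real \<Rightarrow> real \<Rightarrow> real" where
  "g20 s x = (1 + x) * (3 - 2 * x + 3 * x^2 - 2 * s)"

definition dg20 :: "real \<Rightarrow> real \<Rightarrow> real" where
  "dg20 s x = 6 * x + 34 * x^2 + 60 * x^3 + 68 * x^4 + 30 * x^5 - 6 * x^6
     + (x + 3 * x^2 + 11 * x^3 + 9 * x^4) * s"

definition ddg20 :: "real \<Rightarrow> real \<Rightarrow> real" where
  "ddg20 s x = x - 5 * x^2 - 37 * x^3 - 341 * x^4 - 803 * x^5 - 967 * x^6 - 815 * x^7 - 287 * x^8 + 54 * x^9
     + (6 * x + 74 * x^2 + 248 * x^3 + 452 * x^4 + 422 * x^5 + 114 * x^6 - 36 * x^7) * s"

lemma lam20_conj_prod:
  assumes "s\<^sup>2 = quart x" "1 + x \<noteq> 0"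
  shows "lam20 s x * lam20 (- s) x = 16 * x / (1 + x) ^ 6"
    and "(1 - lam20 s x) * (1 - lam20 (- s) x) = 16 * x ^ 5 / (1 + x) ^ 6"
proof -
  define P Q where PQ: "P = (1 + x)^5 + 16 * x * (1 - x) * (1 + x^2)" "Q = (1 - x) * (1 - 6 * x + x^2)"
  have l: "lam20 s x = (P - Q * s) / (2 * (1 + x) ^ 5)" "lam20 (- s) x = (P + Q * s) / (2 * (1 + x) ^ 5)"
    by (simp_all add: lam20_def PQ)
  have "(P - Q * s) * (P + Q * s) = P\<^sup>2 - Q\<^sup>2 * s\<^sup>2"
    by (simp add: algebra_simps power2_eq_square)
  also have "\<dots> = 64 * x * (1 + x) ^ 4"
    unfolding assms(1) by (simp add: PQ quart_def algebra_simps power2_eq_square eval_nat_numeral)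
  finally have prod: "(P - Q * s) * (P + Q * s) = 64 * x * (1 + x) ^ 4" .
  have "lam20 s x * lam20 (- s) x = (64 * x * (1 + x) ^ 4) / (4 * ((1 + x) ^ 5 * (1 + x) ^ 5))"
    unfolding l using prod by simp
  also have "\<dots> = 16 * x / (1 + x) ^ 6"
    using assms(2) by (simp add: divide_simps flip: power_add)
  finally show 1: "lam20 s x * lam20 (- s) x = 16 * x / (1 + x) ^ 6" .
  have "lam20 s x + lam20 (- s) x = P / (1 + x) ^ 5"
    unfolding l using assms(2) by (simp add: divide_simps)
  then have "(1 - lam20 s x) * (1 - lam20 (- s) x) = 1 - P / (1 + x) ^ 5 + 16 * x / (1 + x) ^ 6"
    using 1 by (simp add: algebra_simps)
  also have "1 - P / z ^ 5 + 16 * x / z ^ 6 = (z ^ 6 - P * z + 16 * x) / z ^ 6" if "z \<noteq> 0" for z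
    using that by (simp add: field_simps eval_nat_numeral)
  note this[OF assms(2)]
  also have "(1 + x) ^ 6 - P * (1 + x) + 16 * x = 16 * x ^ 5"
    by (simp add: PQ algebra_simps eval_nat_numeral)
  finally show "(1 - lam20 s x) * (1 - lam20 (- s) x) = 16 * x ^ 5 / (1 + x) ^ 6" .
qed

lemma lam20_conj_sum:
  assumes "1 + x \<noteq> 0"
  shows "lam20 s x + lam20 (- s) x = 1 + 16 * x * (1 - x) * (1 + x^2) / (1 + x) ^ 5"
  using assms by (simp add: lam20_def field_simps)

text \<open>
  Both products of conjugates are positive by the formulas above and both sums are positive on the interval,
  so the two conjugates lie between \<open>0\<close> and \<open>1\<close> without any estimate of \<open>s\<close>.
\<close>

lemma lam20_bounds:
  assumes "s\<^sup>2 = quart x" "0 < x" "x < 1 / 12"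
  shows "0 < lam20 s x" "lam20 s x < 1"
proof -
  let ?p = "16 * x * (1 - x) * (1 + x^2)"
  have x: "1 + x \<noteq> 0" using assms by simp
  have pos: "?p > 0" using assms by (intro mult_pos_pos add_pos_nonneg) auto
  have "(1 - x) * (1 + x^2) \<le> 1"
    using mult_nonneg_nonneg[of x "1 - x + x^2"] add_nonneg_nonneg[of "1 - x" "x^2"] assms
    by (simp add: algebra_simps power2_eq_square)
  then have "16 * x * ((1 - x) * (1 + x^2)) \<le> 16 * x * 1"
    by (rule mult_left_mono) (use assms in simp)
  then have "?p \<le> 16 * x" by (simp only: mult.assoc mult_1_right)
  also have "\<dots> < 1 + 5 * x" using assms by simp
  also have "\<dots> \<le> (1 + x) ^ 5" using Bernoulli_inequality[of x 5] assms by simp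
  finally have "?p / (1 + x) ^ 5 < 1" using assms by simp
  moreover have "?p / (1 + x) ^ 5 > 0" using pos assms by simp
  moreover have "lam20 s x * lam20 (- s) x > 0" "(1 - lam20 s x) * (1 - lam20 (- s) x) > 0"
    unfolding lam20_conj_prod[OF assms(1) x] using assms by auto
  ultimately show "0 < lam20 s x" "lam20 s x < 1"
    using lam20_conj_sum[OF x, of s] unfolding zero_less_mult_iff by auto
qed

lemma g20_conj_prod:
  assumes "s\<^sup>2 = quart x"
  shows "g20 s x * g20 (- s) x = 5 * (1 + x) ^ 6"
proof -
  have "g20 s x * g20 (- s) x = (1 + x)\<^sup>2 * ((3 - 2 * x + 3 * x\<^sup>2)\<^sup>2 - 4 * s\<^sup>2)"
    by (simp add: g20_def algebra_simps power2_eq_square)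
  also have "\<dots> = 5 * (1 + x) ^ 6"
    unfolding assms by (simp add: quart_def algebra_simps power2_eq_square eval_nat_numeral)
  finally show ?thesis .
qed

lemma g20_pos:
  assumes "s\<^sup>2 = quart x" "0 \<le> x" "x < 1"
  shows "g20 s x > 0"
proof -
  have "g20 s x * g20 (- s) x > 0" unfolding g20_conj_prod[OF assms(1)] using assms by simp
  moreover have "g20 s x + g20 (- s) x = 2 * (1 + x) * (3 - 2 * x + 3 * x^2)"
    by (simp add: g20_def algebra_simps)
  moreover have "3 - 2 * x + 3 * x^2 > 0"
    using assms zero_le_power2[of x] by linarith
  then have "2 * (1 + x) * (3 - 2 * x + 3 * x^2) > 0" using assms by simp
  ultimately show ?thesis unfolding zero_less_mult_iff[of "g20 s x"] by linarith
qed

text \<open>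
  The zeros of \<open>g20\<close> at \<open>x = -1\<close> cancel the poles of \<open>lam20\<close>, so this product is a polynomial in \<open>x\<close> and \<open>s\<close>;
  this keeps the degrees small in the verification of the potential.
\<close>

lemma g20_lam20:
  assumes s: "s\<^sup>2 = quart x" and x: "1 + x \<noteq> 0"
  shows "(g20 s x)\<^sup>2 * (lam20 s x * (1 - lam20 s x))
     = 8 * x * (1 - 8 * x + 8 * x^2 - 8 * x^3 + x^4) + 8 * x * (1 - 4 * x + x^2) * s"
    (is "_ = ?M")
proof -
  define P Q C where PQ: "P = 16 * x * (1 - x) * (1 + x^2)" "Q = (1 - x) * (1 - 6 * x + x^2)"
    "C = 3 - 2 * x + 3 * x^2"
  have l: "lam20 s x = ((1 + x)^5 + (P - Q * s)) / (2 * (1 + x) ^ 5)" "g20 s x = (1 + x) * (C - 2 * s)"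
    by (simp_all add: lam20_def g20_def PQ)
  have "(g20 s x)\<^sup>2 * (lam20 s x * (1 - lam20 s x))
     = (C - 2 * s)\<^sup>2 * ((1 + x) ^ 10 - (P - Q * s)\<^sup>2) / (4 * (1 + x) ^ 8)"
    unfolding l using x by (simp add: divide_simps) (simp add: algebra_simps eval_nat_numeral)
  also have "(C - 2 * s)\<^sup>2 * ((1 + x) ^ 10 - (P - Q * s)\<^sup>2) = 
     (C\<^sup>2 + 4 * s\<^sup>2) * ((1 + x) ^ 10 - P\<^sup>2 - Q\<^sup>2 * s\<^sup>2) - 8 * C * P * Q * s\<^sup>2
     + (2 * P * Q * (C\<^sup>2 + 4 * s\<^sup>2) - 4 * C * ((1 + x) ^ 10 - P\<^sup>2 - Q\<^sup>2 * s\<^sup>2)) * s"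
    by (simp add: power2_eq_square algebra_simps)
  also have "(C\<^sup>2 + 4 * s\<^sup>2) * ((1 + x) ^ 10 - P\<^sup>2 - Q\<^sup>2 * s\<^sup>2) - 8 * C * P * Q * s\<^sup>2
     = 8 * x * (1 - 8 * x + 8 * x^2 - 8 * x^3 + x^4) * (4 * (1 + x) ^ 8)"
    unfolding s by (simp add: PQ quart_def algebra_simps eval_nat_numeral)
  also have "2 * P * Q * (C\<^sup>2 + 4 * s\<^sup>2) - 4 * C * ((1 + x) ^ 10 - P\<^sup>2 - Q\<^sup>2 * s\<^sup>2)
     = 8 * x * (1 - 4 * x + x^2) * (4 * (1 + x) ^ 8)"
    unfolding s by (simp add: PQ quart_def algebra_simps eval_nat_numeral)
  also have "(a * (4 * z) + b * (4 * z) * s) / (4 * z) = a + b * s" if "z \<noteq> 0" for a b z :: real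
    using that by (simp add: field_simps)
  note this[OF power_not_zero[OF x]]
  finally show ?thesis .
qed

text \<open>
  The identity has the form \<open>U + V s = 0\<close> with \<open>U\<close>, \<open>V\<close> polynomials in \<open>x\<close> once \<open>s\<^sup>2\<close> is replaced; both
  vanish. It holds for either sign of \<open>s\<close>, which covers the two pull-backs at once.
\<close>

lemma level20_potential:
  assumes s: "s\<^sup>2 = quart x" and x: "1 + x \<noteq> 0"
  shows "4 * potential x * (g20 s x)\<^sup>2
    = - 2 * g20 s x * ddg20 s x + 3 * (dg20 s x)\<^sup>2 + (g20 s x) ^ 4 * (lam20 s x * (1 - lam20 s x))"
proof -
  define m0 m1 where m: "m0 = 8 * x * (1 - 8 * x + 8 * x^2 - 8 * x^3 + x^4)" "m1 = 8 * x * (1 - 4 * x + x^2)"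
  define a b where g: "a = (1 + x) * (3 - 2 * x + 3 * x^2)" "b = - 2 * (1 + x)"
  define c d where dg: "c = 6 * x + 34 * x^2 + 60 * x^3 + 68 * x^4 + 30 * x^5 - 6 * x^6" 
    "d = x + 3 * x^2 + 11 * x^3 + 9 * x^4"
  define e f where ddg: "e = x - 5 * x^2 - 37 * x^3 - 341 * x^4 - 803 * x^5 - 967 * x^6 - 815 * x^7 - 287 * x^8 + 54 * x^9"
     "f = 6 * x + 74 * x^2 + 248 * x^3 + 452 * x^4 + 422 * x^5 + 114 * x^6 - 36 * x^7"
  have eq: "g20 s x = a + b * s" "dg20 s x = c + d * s" "ddg20 s x = e + f * s"
    by (simp_all add: g20_def dg20_def ddg20_def g dg ddg algebra_simps)
  have "(g20 s x) ^ 4 * (lam20 s x * (1 - lam20 s x)) = (g20 s x)\<^sup>2 * ((g20 s x)\<^sup>2 * (lam20 s x * (1 - lam20 s x)))"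
    by (simp add: power2_eq_square eval_nat_numeral mult_ac)
  also have "\<dots> = (a + b * s)\<^sup>2 * (m0 + m1 * s)"
    unfolding g20_lam20[OF s x] unfolding eq m by simp
  finally have g4: "(g20 s x) ^ 4 * (lam20 s x * (1 - lam20 s x)) = (a + b * s)\<^sup>2 * (m0 + m1 * s)" .
  have A: "4 * potential x * (a\<^sup>2 + b\<^sup>2 * s\<^sup>2) + 2 * (a * e + b * f * s\<^sup>2) - 3 * (c\<^sup>2 + d\<^sup>2 * s\<^sup>2)
      - ((a\<^sup>2 + b\<^sup>2 * s\<^sup>2) * m0 + 2 * a * b * m1 * s\<^sup>2) = 0"
    unfolding s by (simp add: potential_def quart_def g dg ddg m algebra_simps eval_nat_numeral)
  have B: "4 * potential x * (2 * a * b) + 2 * (a * f + b * e) - 6 * c * d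
      - ((a\<^sup>2 + b\<^sup>2 * s\<^sup>2) * m1 + 2 * a * b * m0) = 0"
    unfolding s by (simp add: potential_def quart_def g dg ddg m algebra_simps eval_nat_numeral)
  have "4 * potential x * (a + b * s)\<^sup>2 - (- 2 * (a + b * s) * (e + f * s) + 3 * (c + d * s)\<^sup>2 + (a + b * s)\<^sup>2 * (m0 + m1 * s))
     = (4 * potential x * (a\<^sup>2 + b\<^sup>2 * s\<^sup>2) + 2 * (a * e + b * f * s\<^sup>2) - 3 * (c\<^sup>2 + d\<^sup>2 * s\<^sup>2)
      - ((a\<^sup>2 + b\<^sup>2 * s\<^sup>2) * m0 + 2 * a * b * m1 * s\<^sup>2))
      + (4 * potential x * (2 * a * b) + 2 * (a * f + b * e) - 6 * c * d
      - ((a\<^sup>2 + b\<^sup>2 * s\<^sup>2) * m1 + 2 * a * b * m0)) * s"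
    by (simp add: power2_eq_square algebra_simps)
  then show ?thesis unfolding g4 unfolding eq A B by simp
qed

section \<open>Derivatives along the level 20 parametrization\<close>

text \<open>
  Half of the derivative of \<open>quart\<close>, that is \<open>s s'\<close>.
\<close>

definition half_dquart :: "real \<Rightarrow> real" where
  "half_dquart x = - 4 - 2 * x - 12 * x^2 + 2 * x^3"

lemma DERIV_linear_in_root:
  assumes s: "(s has_real_derivative half_dquart x / s x) (at x)" "(s x)\<^sup>2 = quart x"
    and nz: "x \<noteq> 0" "1 + x \<noteq> 0" "s x \<noteq> 0"
    and a: "(a has_real_derivative a') (at x)" and b: "(b has_real_derivative b') (at x)"
  shows "((\<lambda>x. a x + b x * s x) has_real_derivative
    (x * (1 + x) * (b' * quart x + b x * half_dquart x) + x * (1 + x) * a' * s x) / (x * (1 + x) * s x)) (at x)"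
proof (rule DERIV_cong[OF DERIV_add[OF a DERIV_mult[OF b s(1)]]])
  have "a' + (b' * s x + half_dquart x / s x * b x)
     = (a' * s x + (b' * (s x)\<^sup>2 + b x * half_dquart x)) / s x"
    using nz by (simp add: field_simps power2_eq_square)
  also have "\<dots> = (x * (1 + x) * (a' * s x + (b' * quart x + b x * half_dquart x))) / (x * (1 + x) * s x)"
    unfolding s(2) using nz by simp
  finally show "a' + (b' * s x + half_dquart x / s x * b x) =
    (x * (1 + x) * (b' * quart x + b x * half_dquart x) + x * (1 + x) * a' * s x) / (x * (1 + x) * s x)"
    by (simp add: algebra_simps)
qed

lemma DERIV_g20:
  assumes s: "(s has_real_derivative half_dquart x / s x) (at x)" "(s x)\<^sup>2 = quart x"
    and nz: "x \<noteq> 0" "1 + x \<noteq> 0" "s x \<noteq> 0"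
  shows "((\<lambda>x. g20 (s x) x) has_real_derivative dg20 (s x) x / (x * (1 + x) * s x)) (at x)"
proof -
  have a: "((\<lambda>x. (1 + x) * (3 - 2 * x + 3 * x^2)) has_real_derivative 1 + 2 * x + 9 * x^2) (at x)"
    by (rule derivative_eq_intros refl)+ (simp add: algebra_simps power2_eq_square)
  have b: "((\<lambda>x. - 2 * (1 + x)) has_real_derivative - 2) (at x)"
    by (rule derivative_eq_intros refl)+ simp
  have "x * (1 + x) * (- 2 * quart x + - 2 * (1 + x) * half_dquart x) + x * (1 + x) * (1 + 2 * x + 9 * x^2) * s x
     = dg20 (s x) x"
    by (simp add: dg20_def quart_def half_dquart_def algebra_simps eval_nat_numeral)
  with DERIV_linear_in_root[OF s nz a b] show ?thesis
    by (simp add: g20_def[abs_def] algebra_simps)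
qed

lemma DERIV_dg20:
  assumes s: "(s has_real_derivative half_dquart x / s x) (at x)" "(s x)\<^sup>2 = quart x"
    and nz: "x \<noteq> 0" "1 + x \<noteq> 0" "s x \<noteq> 0"
  shows "((\<lambda>x. dg20 (s x) x) has_real_derivative ddg20 (s x) x / (x * (1 + x) * s x)) (at x)"
proof -
  have a: "((\<lambda>x. 6 * x + 34 * x^2 + 60 * x^3 + 68 * x^4 + 30 * x^5 - 6 * x^6) has_real_derivative
      6 + 68 * x + 180 * x^2 + 272 * x^3 + 150 * x^4 - 36 * x^5) (at x)"
    by (rule derivative_eq_intros refl)+ simp
  have b: "((\<lambda>x. x + 3 * x^2 + 11 * x^3 + 9 * x^4) has_real_derivative 1 + 6 * x + 33 * x^2 + 36 * x^3) (at x)"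
    by (rule derivative_eq_intros refl)+ simp
  have "x * (1 + x) * ((1 + 6 * x + 33 * x^2 + 36 * x^3) * quart x + (x + 3 * x^2 + 11 * x^3 + 9 * x^4) * half_dquart x)
      + x * (1 + x) * (6 + 68 * x + 180 * x^2 + 272 * x^3 + 150 * x^4 - 36 * x^5) * s x
     = ddg20 (s x) x"
    by (simp add: ddg20_def quart_def half_dquart_def algebra_simps eval_nat_numeral)
  with DERIV_linear_in_root[OF s nz a b] show ?thesis
    by (simp only: dg20_def[abs_def])
qed

text \<open>
  Multiplying by the conjugate of \<open>g20\<close> clears it from the denominator and leaves an expression that is linear in
  \<open>s\<close>, the form in which derivatives on the curve are computed.
\<close>

lemma g20_lam20_linear:
  assumes s: "s\<^sup>2 = quart x" and x: "0 < x" "x < 1"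
  shows "g20 s x * (lam20 s x * (1 - lam20 s x)) =
    (8 * x * ((1 - 8 * x + 8 * x^2 - 8 * x^3 + x^4) * (3 - 2 * x + 3 * x^2) + 2 * (1 - 4 * x + x^2) * quart x)
    + 8 * x * (2 * (1 - 8 * x + 8 * x^2 - 8 * x^3 + x^4) + (1 - 4 * x + x^2) * (3 - 2 * x + 3 * x^2)) * s)
      / (5 * (1 + x) ^ 5)"
    (is "?L = ?N / _")
proof -
  have g: "g20 s x > 0" using g20_pos[OF s] x by simp
  have x1: "1 + x \<noteq> 0" using x by simp
  have "?L * (5 * (1 + x) ^ 6) = (g20 s x)\<^sup>2 * (lam20 s x * (1 - lam20 s x)) * g20 (- s) x"
    unfolding g20_conj_prod[OF s, symmetric] by (simp add: power2_eq_square mult_ac)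
  also have "\<dots> = (1 + x) * (8 * x * ((1 - 8 * x + 8 * x^2 - 8 * x^3 + x^4) * (3 - 2 * x + 3 * x^2) + 2 * (1 - 4 * x + x^2) * s\<^sup>2)
    + 8 * x * (2 * (1 - 8 * x + 8 * x^2 - 8 * x^3 + x^4) + (1 - 4 * x + x^2) * (3 - 2 * x + 3 * x^2)) * s)"
    unfolding g20_lam20[OF s x1] by (simp add: g20_def algebra_simps eval_nat_numeral)
  also have "\<dots> = (1 + x) * ?N" unfolding s ..
  finally have "?L * (5 * (1 + x) ^ 5) * (1 + x) = ?N * (1 + x)"
    by (simp add: eval_nat_numeral mult_ac)
  then have "?L * (5 * (1 + x) ^ 5) = ?N" using x1 by simp
  then show ?thesis using x1 by (simp add: nonzero_eq_divide_eq)
qed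

lemma DERIV_lam20:
  assumes s: "(s has_real_derivative half_dquart x / s x) (at x)" "(s x)\<^sup>2 = quart x"
    and nz: "0 < x" "x < 1" "s x \<noteq> 0"
  shows "((\<lambda>x. lam20 (s x) x) has_real_derivative
     g20 (s x) x * (lam20 (s x) x * (1 - lam20 (s x) x)) / (x * (1 + x) * s x)) (at x)"
proof -
  define p q where pq: "p = (\<lambda>x :: real. 16 * x * (1 - x) * (1 + x^2))" "q = (\<lambda>x :: real. - ((1 - x) * (1 - 6 * x + x^2)))"
  have nz': "x \<noteq> 0" "1 + x \<noteq> 0" using nz by auto
  have red: "(u' * (2 * z ^ 5) - u * (10 * z ^ 4)) / (2 * z ^ 5 * (2 * z ^ 5)) = (u' * z - 5 * u) / (2 * z ^ 6)"
    if "z \<noteq> 0" for u' u z :: real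
    using that by (simp add: divide_simps) (simp add: algebra_simps eval_nat_numeral)
  have den: "((\<lambda>x. 2 * (1 + x) ^ 5) has_real_derivative 10 * (1 + x) ^ 4) (at x)"
    by (rule derivative_eq_intros refl)+ simp
  have quot: "((\<lambda>x. u x / (2 * (1 + x) ^ 5)) has_real_derivative (u' * (1 + x) - 5 * u x) / (2 * (1 + x) ^ 6)) (at x)"
    if "(u has_real_derivative u') (at x)" for u u'
    by (rule DERIV_cong[OF DERIV_divide[OF that den]]) (use red[OF nz'(2)] nz'(2) in auto)
  have "(p has_real_derivative 16 - 32 * x + 48 * x^2 - 64 * x^3) (at x)" unfolding pq
    by (rule derivative_eq_intros refl)+ (simp add: algebra_simps eval_nat_numeral)
  from DERIV_add[OF DERIV_const[of "1/2"] quot[OF this]]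
  have a: "((\<lambda>x. 1 / 2 + p x / (2 * (1 + x) ^ 5)) has_real_derivative
     ((16 - 32 * x + 48 * x^2 - 64 * x^3) * (1 + x) - 5 * p x) / (2 * (1 + x) ^ 6)) (at x)"
    by simp
  have "(q has_real_derivative 7 - 14 * x + 3 * x^2) (at x)" unfolding pq
    by (rule derivative_eq_intros refl)+ (simp add: algebra_simps eval_nat_numeral)
  note b = quot[OF this]
  have c: "x * (1 + x) * (w / (2 * (1 + x) ^ 6)) = x * w / (2 * (1 + x) ^ 5)" for w
    using nz'(2) by (simp add: eval_nat_numeral)
  have A: "x * (1 + x) * (((16 - 32 * x + 48 * x^2 - 64 * x^3) * (1 + x) - 5 * p x) / (2 * (1 + x) ^ 6))
     = 8 * x * (2 * (1 - 8 * x + 8 * x^2 - 8 * x^3 + x^4) + (1 - 4 * x + x^2) * (3 - 2 * x + 3 * x^2)) / (5 * (1 + x) ^ 5)"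
  proof -
    have "x * ((16 - 32 * x + 48 * x^2 - 64 * x^3) * (1 + x) - 5 * p x) * 5
       = 8 * x * (2 * (1 - 8 * x + 8 * x^2 - 8 * x^3 + x^4) + (1 - 4 * x + x^2) * (3 - 2 * x + 3 * x^2)) * 2"
      by (simp add: pq algebra_simps eval_nat_numeral)
    then show ?thesis unfolding c using nz'(2) by (simp add: frac_eq_eq mult_ac)
  qed
  have B: "x * (1 + x) * (((7 - 14 * x + 3 * x^2) * (1 + x) - 5 * q x) / (2 * (1 + x) ^ 6) * quart x
        + q x / (2 * (1 + x) ^ 5) * half_dquart x)
     = 8 * x * ((1 - 8 * x + 8 * x^2 - 8 * x^3 + x^4) * (3 - 2 * x + 3 * x^2) + 2 * (1 - 4 * x + x^2) * quart x) / (5 * (1 + x) ^ 5)"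
  proof -
    have "x * (((7 - 14 * x + 3 * x^2) * (1 + x) - 5 * q x) * quart x + (1 + x) * q x * half_dquart x) * 5
       = 8 * x * ((1 - 8 * x + 8 * x^2 - 8 * x^3 + x^4) * (3 - 2 * x + 3 * x^2) + 2 * (1 - 4 * x + x^2) * quart x) * 2"
      by (simp add: pq quart_def half_dquart_def algebra_simps eval_nat_numeral)
    moreover have e: "w / (2 * (1 + x) ^ 6) * quart x + q x / (2 * (1 + x) ^ 5) * half_dquart x
       = (w * quart x + (1 + x) * q x * half_dquart x) / (2 * (1 + x) ^ 6)" for w
      using nz'(2) by (simp add: divide_simps) (simp add: algebra_simps eval_nat_numeral)
    ultimately show ?thesis unfolding e c using nz'(2) by (simp add: frac_eq_eq mult_ac)
  qed
  have l: "lam20 (s x) x = 1 / 2 + p x / (2 * (1 + x) ^ 5) + q x / (2 * (1 + x) ^ 5) * s x" if "1 + x \<noteq> 0" for x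
    using that by (simp add: lam20_def pq field_simps)
  have "eventually (\<lambda>y. y \<in> {-1<..}) (nhds x)"
    using nz by (intro eventually_nhds_in_open) auto
  then have ev: "eventually (\<lambda>x. lam20 (s x) x = 1 / 2 + p x / (2 * (1 + x) ^ 5) + q x / (2 * (1 + x) ^ 5) * s x) (nhds x)"
    by eventually_elim (use l in auto)
  show ?thesis
    unfolding DERIV_cong_ev[OF refl ev refl]
    using DERIV_linear_in_root[OF s nz'(1,2) nz(3) a b]
    unfolding A B g20_lam20_linear[OF s(2) nz(1,2)] by (simp add: add_divide_distrib)
qed

section \<open>The generating function as a square of elliptic integrals\<close>

lemma quart_pos:
  assumes "0 \<le> x" "x < 1 / 12" shows "quart x > 0"
proof -
  have "x * x \<le> 1 / 12 * (1 / 12)" "x * (x * x) \<le> 1 / 12 * (1 / 12 * (1 / 12))"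
    using assms by (intro mult_mono; simp)+
  moreover have "x ^ 4 \<ge> 0" by simp
  ultimately show ?thesis using assms
    unfolding quart_def power2_eq_square power3_eq_cube mult.assoc by linarith
qed

definition root20 :: "real \<Rightarrow> real" where "root20 x = sqrt (quart x)"

lemma root20:
  assumes "0 \<le> x" "x < 1 / 12"
  shows root20_pos: "root20 x > 0" and root20_sq: "(root20 x)\<^sup>2 = quart x"
  using quart_pos[OF assms] by (simp_all add: root20_def)

lemma root20_0 [simp]: "root20 0 = 1"
  by (simp add: root20_def quart_def)

lemma DERIV_quart: "(quart has_real_derivative 2 * half_dquart x) (at x)"
  unfolding quart_def[abs_def]
  by (rule derivative_eq_intros refl)+ (simp add: half_dquart_def)

lemma DERIV_root20:
  assumes "0 \<le> x" "x < 1 / 12"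
  shows "(root20 has_real_derivative half_dquart x / root20 x) (at x)"
  unfolding root20_def[abs_def]
  by (rule DERIV_cong[OF DERIV_chain2[where f = sqrt and g = quart, OF DERIV_real_sqrt DERIV_quart]])
    (use quart_pos[OF assms] in \<open>simp_all add: field_split_simps\<close>)

lemma continuous_on_root20: "continuous_on {0..<1/12} root20"
  unfolding root20_def[abs_def] quart_def[abs_def] by (intro continuous_intros)

text \<open>
  For \<open>e = 1\<close> this is the lambda function at \<open>2 tau\<close>, for \<open>e = -1\<close> the one at \<open>10 tau\<close>. Both vanish at
  \<open>x = 0\<close>, to the orders \<open>1\<close> and \<open>5\<close>. Passing from \<open>lam20\<close> to \<open>1 - lam20\<close> and reversing the sign of \<open>s\<close> both
  negate \<open>D lam20\<close>, so \<open>D mu = gmu mu (1 - mu)\<close> holds for either sign.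
\<close>

definition mu :: "real \<Rightarrow> real \<Rightarrow> real" where
  "mu e x = (1 - e) / 2 + e * lam20 (e * root20 x) x"

definition gmu :: "real \<Rightarrow> real \<Rightarrow> real" where
  "gmu e x = g20 (e * root20 x) x"

definition dgmu :: "real \<Rightarrow> real \<Rightarrow> real" where
  "dgmu e x = e * dg20 (e * root20 x) x"

definition h20 :: "real \<Rightarrow> real" where
  "h20 x = x * (1 + x) * root20 x"

lemma h20_pos: "0 < x \<Longrightarrow> x < 1 / 12 \<Longrightarrow> h20 x > 0"
  using root20_pos[of x] by (simp add: h20_def)

context
  fixes e :: real
  assumes e: "e = 1 \<or> e = - 1"
begin

lemma e_sq: "e * e = 1" "e\<^sup>2 = 1"
  using e by auto

lemma e_root20_sq: "0 \<le> x \<Longrightarrow> x < 1 / 12 \<Longrightarrow> (e * root20 x)\<^sup>2 = quart x"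
  by (simp add: power_mult_distrib e_sq root20_sq)

lemma mu_conj: "mu e x * (1 - mu e x) = lam20 (e * root20 x) x * (1 - lam20 (e * root20 x) x)"
  using e by (auto simp: mu_def)

lemma mu_0: "mu e 0 = 0"
  using e by (auto simp: mu_def lam20_def)

lemma mu_bounds:
  assumes "0 < x" "x < 1 / 12" shows "0 < mu e x" "mu e x < 1"
  using lam20_bounds[OF e_root20_sq, of x] assms e by (auto simp: mu_def)

lemma gmu_pos: "0 \<le> x \<Longrightarrow> x < 1 / 12 \<Longrightarrow> gmu e x > 0"
  unfolding gmu_def by (rule g20_pos[OF e_root20_sq]) auto

lemma gmu_DERIV:
  assumes "0 < x" "x < 1 / 12"
  shows DERIV_mu: "(mu e has_real_derivative gmu e x * (mu e x * (1 - mu e x)) / h20 x) (at x)"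
    and DERIV_gmu: "(gmu e has_real_derivative dgmu e x / h20 x) (at x)"
    and DERIV_dgmu: "(dgmu e has_real_derivative ddg20 (e * root20 x) x / h20 x) (at x)"
proof -
  have r: "root20 x > 0" "x * (1 + x) \<noteq> 0" using root20_pos[of x] assms by auto
  have s: "((\<lambda>x. e * root20 x) has_real_derivative half_dquart x / (e * root20 x)) (at x)"
    by (rule DERIV_cong[OF DERIV_cmult[OF DERIV_root20]]) (use assms r e in auto)
  have ex: "e * (w / (x * (1 + x) * (e * root20 x))) = w / h20 x" "w / (x * (1 + x) * (e * root20 x)) = e * w / h20 x" for w
    using e by (auto simp: h20_def)
  have sq: "(e * root20 x)\<^sup>2 = quart x" using assms e_root20_sq[of x] by simp
  have nz: "x < 1" "e * root20 x \<noteq> 0" "x \<noteq> 0" "1 + x \<noteq> 0" using r assms e by auto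
  show "(mu e has_real_derivative gmu e x * (mu e x * (1 - mu e x)) / h20 x) (at x)"
    using DERIV_add[OF DERIV_const[of "(1 - e) / 2"] DERIV_cmult[OF DERIV_lam20[OF s sq assms(1) nz(1,2)], of e]]
    unfolding mu_conj unfolding mu_def[abs_def] ex(1) gmu_def by simp
  show "(gmu e has_real_derivative dgmu e x / h20 x) (at x)"
    using DERIV_g20[OF s sq nz(3,4,2)] unfolding ex(2) by (simp add: gmu_def[abs_def] dgmu_def)
  show "(dgmu e has_real_derivative ddg20 (e * root20 x) x / h20 x) (at x)"
    using DERIV_cmult[OF DERIV_dg20[OF s sq nz(3,4,2)], of e] unfolding ex(1) by (simp add: dgmu_def[abs_def])
qed

lemma continuous_on_mu: "continuous_on {0..<1/12} (mu e)"
  unfolding mu_def[abs_def] lam20_def by (intro continuous_intros continuous_on_root20) auto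

lemma mu_image: "mu e ` {0..<1/12} \<subseteq> {0..<1}"
proof
  fix y assume "y \<in> mu e ` {0..<1/12}"
  then obtain x where x: "0 \<le> x" "x < 1 / 12" "y = mu e x" by auto
  then show "y \<in> {0..<1}" using mu_bounds[of x] mu_0 by (cases "x = 0") auto
qed

lemma continuous_on_pull:
  shows "continuous_on {0..<1/12} (pull_y (gmu e) (mu e))"
    and "continuous_on {0..<1/12} (pull_v (gmu e) (dgmu e) (mu e))"
proof -
  have g: "continuous_on {0..<1/12} (gmu e)"
    unfolding gmu_def[abs_def] g20_def by (intro continuous_intros continuous_on_root20)
  have dg: "continuous_on {0..<1/12} (dgmu e)"
    unfolding dgmu_def[abs_def] dg20_def by (intro continuous_intros continuous_on_root20)
  have F: "continuous_on {0..<1/12} (\<lambda>x. hypF (mu e x))"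
    by (rule continuous_on_compose2[OF continuous_on_hypF continuous_on_mu mu_image])
  have G: "continuous_on {0..<1/12} (\<lambda>x. hypG (mu e x))"
    by (rule continuous_on_compose2[OF continuous_on_hypG continuous_on_mu mu_image])
  have nz: "\<forall>x\<in>{0..<1/12}. sqrt (gmu e x) \<noteq> 0" "\<forall>x\<in>{0..<1/12}. 2 * gmu e x * sqrt (gmu e x) \<noteq> 0"
    using gmu_pos by force+
  show "continuous_on {0..<1/12} (pull_y (gmu e) (mu e))"
    unfolding pull_y_def[abs_def] by (intro continuous_intros F g nz)
  show "continuous_on {0..<1/12} (pull_v (gmu e) (dgmu e) (mu e))"
    unfolding pull_v_def[abs_def] by (intro continuous_intros F G g dg nz)
qed

lemma pull_DERIV:
  assumes "0 < x" "x < 1 / 12"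
  shows "(pull_y (gmu e) (mu e) has_real_derivative pull_v (gmu e) (dgmu e) (mu e) x / h20 x) (at x)"
    and "(pull_v (gmu e) (dgmu e) (mu e) has_real_derivative potential x * pull_y (gmu e) (mu e) x / h20 x) (at x)"
proof -
  have "4 * potential x * (gmu e x)\<^sup>2 = - 2 * gmu e x * ddg20 (e * root20 x) x + 3 * (dgmu e x)\<^sup>2
      + (gmu e x) ^ 4 * (mu e x * (1 - mu e x))"
    unfolding mu_conj gmu_def dgmu_def using level20_potential[OF e_root20_sq, of x] assms
    by (simp add: power_mult_distrib e_sq)
  note * = pull_y_v_DERIV[OF gmu_DERIV[OF assms] gmu_pos mu_bounds[OF assms] h20_pos[OF assms] this]
  show "(pull_y (gmu e) (mu e) has_real_derivative pull_v (gmu e) (dgmu e) (mu e) x / h20 x) (at x)"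
    by (rule *(1)) (use assms in auto)
  show "(pull_v (gmu e) (dgmu e) (mu e) has_real_derivative potential x * pull_y (gmu e) (mu e) x / h20 x) (at x)"
    by (rule *(2)) (use assms in auto)
qed

lemma gmu_0: "gmu e 0 = 3 - 2 * e"
  by (simp add: gmu_def g20_def)

lemma pull_v_0: "pull_v (gmu e) (dgmu e) (mu e) 0 = 0"
  by (simp add: pull_v_def mu_0 hypG_0 dgmu_def dg20_def)

end

context level20_sequence
begin

lemma genfun_DERIV:
  assumes "0 < x" "x < 1 / 12"
  shows "(genfun 0 has_real_derivative (1 + x) * root20 x * genfun 1 x / h20 x) (at x)"
    and "((\<lambda>x. (1 + x) * root20 x * genfun 1 x) has_real_derivative
       (disc_poly x * genfun 2 x + disc_poly1 x / 2 * genfun 1 x) / h20 x) (at x)"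
    and "((\<lambda>x. disc_poly x * genfun 2 x + disc_poly1 x / 2 * genfun 1 x) has_real_derivative
       (4 * potential x * ((1 + x) * root20 x * genfun 1 x) + 2 * ((1 + x) * root20 x * potential1 x) * genfun 0 x) / h20 x) (at x)"
    and "(potential has_real_derivative (1 + x) * root20 x * potential1 x / h20 x) (at x)"
proof -
  have r: "root20 x > 0" using root20_pos[of x] assms by auto
  have x: "\<bar>x\<bar> < 1 / 10" "x \<noteq> 0" "1 + x \<noteq> 0" using assms by auto
  have red: "(1 + x) * root20 x * w / h20 x = w / x" for w
    using r x by (simp add: h20_def)
  have genfun: "(genfun 1 has_real_derivative genfun 2 x / x) (at x)" "(genfun 2 has_real_derivative genfun 3 x / x) (at x)"
    using DERIV_genfun[OF x(1,2), of 1] DERIV_genfun[OF x(1,2), of 2] by (simp_all add: numeral_2_eq_2 numeral_3_eq_3)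
  show "(genfun 0 has_real_derivative (1 + x) * root20 x * genfun 1 x / h20 x) (at x)"
    unfolding red using DERIV_genfun[OF x(1,2), of 0] by simp
  have sq: "root20 x * root20 x = quart x" using root20_sq[of x] assms by (simp add: power2_eq_square)
  show "((\<lambda>x. (1 + x) * root20 x * genfun 1 x) has_real_derivative
       (disc_poly x * genfun 2 x + disc_poly1 x / 2 * genfun 1 x) / h20 x) (at x)"
  proof (rule DERIV_cong[OF DERIV_mult[OF DERIV_mult[OF _ DERIV_root20] genfun(1)]])
    show "((\<lambda>x. 1 + x) has_real_derivative 1) (at x)" by (rule derivative_eq_intros refl)+ simp
    have w: "disc_poly x = (1 + x)\<^sup>2 * quart x" "disc_poly1 x = 2 * (x * (1 + x) * (quart x + (1 + x) * half_dquart x))"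
      by (simp_all add: disc_poly_def disc_poly1_def quart_def half_dquart_def algebra_simps eval_nat_numeral)
    show "(1 * root20 x + half_dquart x / root20 x * (1 + x)) * genfun 1 x + genfun 2 x / x * ((1 + x) * root20 x) =
        (disc_poly x * genfun 2 x + disc_poly1 x / 2 * genfun 1 x) / h20 x"
      unfolding w sq[symmetric] h20_def using r x by (simp add: divide_simps) (simp add: algebra_simps power2_eq_square)
  qed (use assms in auto)
  have dw: "(disc_poly has_real_derivative disc_poly1 x / x) (at x)"
    unfolding disc_poly_def[abs_def] 
    by (rule derivative_eq_intros refl)+ (use x in \<open>simp add: disc_poly1_def field_simps eval_nat_numeral\<close>)
  have "(disc_poly1 has_real_derivative disc_poly2 x / x) (at x)"
    unfolding disc_poly1_def[abs_def]
    by (rule derivative_eq_intros refl)+ (use x in \<open>simp add: disc_poly2_def field_simps eval_nat_numeral\<close>)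
  from DERIV_cdivide[OF this, of 2]
  have dw1: "((\<lambda>x. disc_poly1 x / 2) has_real_derivative disc_poly2 x / 2 / x) (at x)"
    by (simp add: mult.commute)
  show "((\<lambda>x. disc_poly x * genfun 2 x + disc_poly1 x / 2 * genfun 1 x) has_real_derivative
       (4 * potential x * ((1 + x) * root20 x * genfun 1 x) + 2 * ((1 + x) * root20 x * potential1 x) * genfun 0 x) / h20 x) (at x)"
  proof (rule DERIV_cong[OF DERIV_add[OF DERIV_mult[OF dw genfun(2)] DERIV_mult[OF dw1 genfun(1)]]])
    have "disc_poly1 x / x * genfun 2 x + genfun 3 x / x * disc_poly x + (disc_poly2 x / 2 / x * genfun 1 x + genfun 2 x / x * (disc_poly1 x / 2))
       = (disc_poly x * genfun 3 x + 3 / 2 * disc_poly1 x * genfun 2 x + disc_poly2 x / 2 * genfun 1 x) / x"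
      using x by (simp add: field_simps)
    also have "disc_poly x * genfun 3 x + 3 / 2 * disc_poly1 x * genfun 2 x + disc_poly2 x / 2 * genfun 1 x
       = 4 * potential x * genfun 1 x + 2 * potential1 x * genfun 0 x"
      using genfun_ode[OF x(1)] by (simp add: algebra_simps)
    also have "\<dots> / x = (4 * potential x * ((1 + x) * root20 x * genfun 1 x) + 2 * ((1 + x) * root20 x * potential1 x) * genfun 0 x) / h20 x"
      unfolding red[symmetric] by (simp add: algebra_simps)
    finally show "disc_poly1 x / x * genfun 2 x + genfun 3 x / x * disc_poly x + (disc_poly2 x / 2 / x * genfun 1 x + genfun 2 x / x * (disc_poly1 x / 2))
       = (4 * potential x * ((1 + x) * root20 x * genfun 1 x) + 2 * ((1 + x) * root20 x * potential1 x) * genfun 0 x) / h20 x" .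
  qed
  show "(potential has_real_derivative (1 + x) * root20 x * potential1 x / h20 x) (at x)"
  proof (rule DERIV_cong)
    show "(potential has_real_derivative 1 / 2 + 27 / 2 * x + 42 * x^2 + 78 * x^3 + 95 / 2 * x^4 - 27 / 2 * x^5) (at x)"
      unfolding potential_def[abs_def] by (auto intro!: derivative_eq_intros)
    show "1 / 2 + 27 / 2 * x + 42 * x^2 + 78 * x^3 + 95 / 2 * x^4 - 27 / 2 * x^5 = (1 + x) * root20 x * potential1 x / h20 x"
      unfolding red using x by (simp add: potential1_def field_simps eval_nat_numeral)
  qed
qed

text \<open>
  Both pull-backs have the potential of the recurrence and are regular at \<open>0\<close>, so the generating function is a
  multiple of the square of either one. The factor \<open>3 - 2e\<close>, equal to \<open>1\<close> or \<open>5\<close>, is the value of \<open>g\<close> at \<open>0\<close>.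
\<close>

lemma genfun_0_eq_pull:
  assumes e: "e = 1 \<or> e = - 1" and x: "0 \<le> x" "x < 1 / 12"
  shows "genfun 0 x = (3 - 2 * e) * (pull_y (gmu e) (mu e) x)\<^sup>2"
proof -
  let ?y = "pull_y (gmu e) (mu e)"
  have ypos: "?y x > 0" if "0 \<le> x" "x < 1 / 12" for x
  proof -
    have "mu e x \<in> {0..<1}"
      by (rule subsetD[OF mu_image[OF e]]) (use that in auto)
    then show ?thesis
      unfolding pull_y_def using gmu_pos[OF e that] by (auto intro!: divide_pos_pos hypF_pos)
  qed
  have cont_genfun: "continuous_on {0..<1/12} (genfun k)" for k
    by (rule continuous_on_subset[OF continuous_on_genfun]) auto
  have "genfun 0 x / (?y x)\<^sup>2 = genfun 0 0 / (?y 0)\<^sup>2"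
  proof (rule symmetric_square_solution[where r = "1 / 12" and h = h20 and v = "pull_v (gmu e) (dgmu e) (mu e)" and R = potential])
    fix x :: real assume x: "0 < x" "x < 1 / 12"
    show "h20 x > 0" by (rule h20_pos[OF x])
    note pull_DERIV[OF e x] genfun_DERIV[OF x]
    then show "(?y has_real_derivative pull_v (gmu e) (dgmu e) (mu e) x / h20 x) (at x)"
      "(pull_v (gmu e) (dgmu e) (mu e) has_real_derivative potential x * ?y x / h20 x) (at x)"
      "(genfun 0 has_real_derivative (1 + x) * root20 x * genfun 1 x / h20 x) (at x)"
      "((\<lambda>x. (1 + x) * root20 x * genfun 1 x) has_real_derivative
         (disc_poly x * genfun 2 x + disc_poly1 x / 2 * genfun 1 x) / h20 x) (at x)"
      "((\<lambda>x. disc_poly x * genfun 2 x + disc_poly1 x / 2 * genfun 1 x) has_real_derivative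
         (4 * potential x * ((1 + x) * root20 x * genfun 1 x) + 2 * ((1 + x) * root20 x * potential1 x) * genfun 0 x) / h20 x) (at x)"
      "(potential has_real_derivative (1 + x) * root20 x * potential1 x / h20 x) (at x)"
      by blast+
  next
    show "continuous_on {0..<1 / 12} potential" unfolding potential_def[abs_def] by (intro continuous_intros) auto
    show "continuous_on {0..<1 / 12} (\<lambda>x. (1 + x) * root20 x * genfun 1 x)"
      by (intro continuous_intros cont_genfun continuous_on_root20)
    show "continuous_on {0..<1 / 12} (\<lambda>x. disc_poly x * genfun 2 x + disc_poly1 x / 2 * genfun 1 x)"
      unfolding disc_poly_def disc_poly1_def by (intro continuous_intros cont_genfun) auto
  qed (use x ypos cont_genfun continuous_on_pull[OF e] pull_v_0[OF e] in \<open>auto simp: genfun_at_0 potential_def\<close>)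
  moreover have "(?y 0)\<^sup>2 = 1 / (3 - 2 * e)"
    using e by (auto simp: pull_y_def mu_0 hypF_0 gmu_0 power_divide)
  ultimately show ?thesis using ypos[OF x] e by (auto simp: genfun_at_0 field_simps)
qed

lemma genfun_0_eq_hypF:
  assumes e: "e = 1 \<or> e = - 1" and x: "0 \<le> x" "x < 1 / 12"
  shows "gmu e x * genfun 0 x = (3 - 2 * e) * (hypF (mu e x))\<^sup>2"
  unfolding genfun_0_eq_pull[OF assms] pull_y_def using gmu_pos[OF assms] by (simp add: power_divide)

lemma genfun_1_eq_hypF:
  assumes e: "e = 1 \<or> e = - 1" and x: "0 < x" "x < 1 / 12"
  shows "(1 + x) * root20 x * genfun 1 x =
     (3 - 2 * e) * (2 * hypF (mu e x) * hypG (mu e x)) - dgmu e x / gmu e x * genfun 0 x"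
proof -
  let ?y = "pull_y (gmu e) (mu e)" and ?v = "pull_v (gmu e) (dgmu e) (mu e)"
  have g: "gmu e x > 0" using gmu_pos[OF e] x by simp
  have "eventually (\<lambda>y. y \<in> {0<..<1/12}) (nhds x)"
    using x by (intro eventually_nhds_in_open) auto
  then have ev: "eventually (\<lambda>x. genfun 0 x = (3 - 2 * e) * (?y x)\<^sup>2) (nhds x)"
    by eventually_elim (auto intro: genfun_0_eq_pull[OF e])
  have "((\<lambda>x. (3 - 2 * e) * (?y x)\<^sup>2) has_real_derivative (3 - 2 * e) * (2 * ?y x * ?v x) / h20 x) (at x)"
    by (rule DERIV_cong[OF DERIV_cmult[OF DERIV_power[OF pull_DERIV(1)[OF e x], of 2]]]) simp
  then have "(genfun 0 has_real_derivative (3 - 2 * e) * (2 * ?y x * ?v x) / h20 x) (at x)"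
    unfolding DERIV_cong_ev[OF refl ev refl] .
  from DERIV_unique[OF this genfun_DERIV(1)[OF x]]
  have "(1 + x) * root20 x * genfun 1 x = (3 - 2 * e) * (2 * ?y x * ?v x)"
    using h20_pos[OF x] by simp
  also have "\<dots> = (3 - 2 * e) * (2 * hypF (mu e x) * hypG (mu e x)) - dgmu e x / gmu e x * ((3 - 2 * e) * (?y x)\<^sup>2)"
  proof -
    define s where "s = sqrt (gmu e x)"
    have s: "s > 0" "gmu e x = s\<^sup>2" using g by (simp_all add: s_def)
    show ?thesis unfolding pull_y_def pull_v_def s_def[symmetric] unfolding s(2)
      using s(1) by (simp add: field_simps power2_eq_square)
  qed
  finally show ?thesis using genfun_0_eq_pull[OF e, of x] x by simp
qed

end

section \<open>The cubic transformation\<close>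

text \<open>
  The classical parametrization of the cubic modular equation, and the coefficient of the derivation
  \<open>D\<close> for which both moduli are pull-backs with one potential.
\<close>

definition cubic_alpha :: "real \<Rightarrow> real" where
  "cubic_alpha p = p * (2 + p)^3 / (1 + 2 * p)^3"

definition cubic_beta :: "real \<Rightarrow> real" where
  "cubic_beta p = p^3 * (2 + p) / (1 + 2 * p)"

definition h_cubic :: "real \<Rightarrow> real" where
  "h_cubic p = p * (2 + p) * (1 - p^2)"

lemma h_cubic_pos:
  assumes "0 < p" "p < 1" shows "h_cubic p > 0"
  using assms power_less_one_iff[of p 2] by (simp add: h_cubic_def)

lemma cubic_complement:
  assumes "0 \<le> p"
  shows "1 - cubic_alpha p = (1 - p)^3 * (1 + p) / (1 + 2 * p)^3"
    and "1 - cubic_beta p = (1 - p) * (1 + p)^3 / (1 + 2 * p)"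
  using assms by (simp_all add: cubic_alpha_def cubic_beta_def divide_simps)
    (simp_all add: algebra_simps eval_nat_numeral)

lemma cubic_bounds:
  assumes "0 < p" "p < 1"
  shows "0 < cubic_alpha p" "cubic_alpha p < 1" "0 < cubic_beta p" "cubic_beta p < 1"
proof -
  show "0 < cubic_alpha p" "0 < cubic_beta p" using assms by (simp_all add: cubic_alpha_def cubic_beta_def)
  have "1 - cubic_alpha p > 0" "1 - cubic_beta p > 0"
    using assms cubic_complement[of p] by simp_all
  then show "cubic_alpha p < 1" "cubic_beta p < 1" by simp_all
qed

lemma DERIV_cubic_alpha:
  assumes "0 < p" "p < 1"
  shows "(cubic_alpha has_real_derivative
    2 * (1 + 2 * p)\<^sup>2 * (cubic_alpha p * (1 - cubic_alpha p)) / h_cubic p) (at p)"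
proof -
  have nz: "1 + 2 * p \<noteq> 0" "2 + p \<noteq> 0" "p \<noteq> 0" "1 + p \<noteq> 0" "1 - p \<noteq> 0" using assms by auto
  have n: "((\<lambda>p. p * (2 + p)^3) has_real_derivative (2 + p)^2 * (2 + 4 * p)) (at p)"
    by (rule derivative_eq_intros refl)+ (simp add: algebra_simps eval_nat_numeral)
  have d: "((\<lambda>p. (1 + 2 * p)^3) has_real_derivative 6 * (1 + 2 * p)^2) (at p)"
    by (rule derivative_eq_intros refl)+ simp
  define z where "z = 1 + 2 * p"
  have h: "h_cubic p = p * (2 + p) * ((1 - p) * (1 + p))"
    by (simp add: h_cubic_def algebra_simps power2_eq_square)
  have "((2 + p)^2 * (2 + 4 * p) * z^3 - p * (2 + p)^3 * (6 * z^2)) / (z^3 * z^3)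
     = 2 * (2 + p)^2 * (z * z - 3 * p * (2 + p)) / z ^ 4"
    using nz(1) by (simp add: divide_simps flip: z_def) (simp add: z_def algebra_simps eval_nat_numeral)
  also have "z * z - 3 * p * (2 + p) = (1 - p)\<^sup>2"
    by (simp add: z_def algebra_simps power2_eq_square)
  also have "2 * (2 + p)^2 * (1 - p)\<^sup>2 / z ^ 4
    = 2 * z\<^sup>2 * (cubic_alpha p * ((1 - p)^3 * (1 + p) / z^3)) / h_cubic p"
    unfolding h cubic_alpha_def z_def[symmetric] using nz by (simp add: divide_simps flip: z_def)
       (simp add: algebra_simps eval_nat_numeral)
  finally show ?thesis
    using cubic_complement(1)[of p] assms DERIV_divide[OF n d] nz(1)
    by (simp add: cubic_alpha_def[abs_def] z_def)
qed

lemma DERIV_cubic_beta: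
  assumes "0 < p" "p < 1"
  shows "(cubic_beta has_real_derivative 6 * (cubic_beta p * (1 - cubic_beta p)) / h_cubic p) (at p)"
proof -
  have nz: "1 + 2 * p \<noteq> 0" "2 + p \<noteq> 0" "p \<noteq> 0" "1 + p \<noteq> 0" "1 - p \<noteq> 0" using assms by auto
  have n: "((\<lambda>p. p^3 * (2 + p)) has_real_derivative p^2 * (6 + 4 * p)) (at p)"
    by (rule derivative_eq_intros refl)+ (simp add: algebra_simps eval_nat_numeral)
  have d: "((\<lambda>p. 1 + 2 * p) has_real_derivative 2) (at p)"
    by (rule derivative_eq_intros refl)+ simp
  define z where "z = 1 + 2 * p"
  have h: "h_cubic p = p * (2 + p) * ((1 - p) * (1 + p))"
    by (simp add: h_cubic_def algebra_simps power2_eq_square)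
  have "p^2 * (6 + 4 * p) * z - p^3 * (2 + p) * 2 = 6 * p^2 * (1 + p)^2"
    by (simp add: z_def algebra_simps eval_nat_numeral)
  then have "(p^2 * (6 + 4 * p) * z - p^3 * (2 + p) * 2) / (z * z) = 6 * p^2 * (1 + p)^2 / (z * z)"
    by simp
  also have "\<dots> = 6 * (cubic_beta p * ((1 - p) * (1 + p)^3 / z)) / h_cubic p"
    unfolding h cubic_beta_def z_def[symmetric] using nz by (simp add: divide_simps flip: z_def)
       (simp add: algebra_simps eval_nat_numeral)
  finally show ?thesis
    using cubic_complement(2)[of p] assms DERIV_divide[OF n d] nz(1)
    by (simp add: cubic_beta_def[abs_def] z_def)
qed

lemma cubic_potential:
  assumes "0 \<le> p"
  shows "4 * (9 * (cubic_beta p * (1 - cubic_beta p))) * (2 * (1 + 2 * p)\<^sup>2)\<^sup>2 =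
    - 2 * (2 * (1 + 2 * p)\<^sup>2) * (h_cubic p * (16 + 80 * p - 160 * p^3 - 80 * p^4))
    + 3 * (8 * (1 + 2 * p) * h_cubic p)\<^sup>2
    + (2 * (1 + 2 * p)\<^sup>2) ^ 4 * (cubic_alpha p * (1 - cubic_alpha p))"
proof -
  define z where "z = 1 + 2 * p"
  have z: "z \<noteq> 0" using assms by (simp add: z_def)
  have "9 * p^3 * (2 + p) * ((1 - p) * (1 + p)^3) * 16 * z\<^sup>2 =
    - 4 * z\<^sup>2 * (h_cubic p * (16 + 80 * p - 160 * p^3 - 80 * p^4)) + 192 * z\<^sup>2 * (h_cubic p)\<^sup>2
    + 16 * z\<^sup>2 * (p * (2 + p)^3 * ((1 - p)^3 * (1 + p)))"
    by (simp add: h_cubic_def z_def algebra_simps eval_nat_numeral)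
  moreover have "4 * (9 * (a / z * (b / z))) * (2 * z\<^sup>2)\<^sup>2 = 9 * a * b * 16 * z\<^sup>2" for a b
    using z by (simp add: power2_eq_square)
  moreover have "(2 * z\<^sup>2) ^ 4 * (a / z ^ 3 * (b / z ^ 3)) = 16 * z\<^sup>2 * (a * b)" for a b
    using z by (simp add: eval_nat_numeral)
  moreover have "- 2 * (2 * z\<^sup>2) * a = - 4 * z\<^sup>2 * a" "3 * (8 * z * a)\<^sup>2 = 192 * z\<^sup>2 * a\<^sup>2" for a
    by (simp_all add: power_mult_distrib)
  ultimately show ?thesis
    unfolding cubic_complement[OF assms] unfolding cubic_beta_def cubic_alpha_def z_def[symmetric]
    by (simp only:)
qed

lemma cubic_image:
  assumes "0 \<le> p" "p < 1"
  shows "cubic_alpha p \<in> {0..<1}" "cubic_beta p \<in> {0..<1}"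
  using cubic_bounds[of p] assms by (cases "p = 0"; simp add: cubic_alpha_def cubic_beta_def)+

text \<open>
  Pulling back along \<open>alpha\<close> with \<open>g = 2 (1 + 2p)\<^sup>2\<close> and along \<open>beta\<close> with the constant \<open>g = 6\<close>
  gives the same potential \<open>9 beta (1 - beta)\<close>. The two solutions are therefore proportional, and \<open>p = 0\<close> determines the
  factor.
\<close>

lemma cubic_transformation:
  assumes "0 \<le> p" "p < 1"
  shows "hypF (cubic_alpha p) = (1 + 2 * p) * hypF (cubic_beta p)"
proof -
  define ga where "ga = (\<lambda>p :: real. 2 * (1 + 2 * p)\<^sup>2)"
  define dga where "dga = (\<lambda>p :: real. 8 * (1 + 2 * p) * h_cubic p)"
  define gb dgb where "gb = (\<lambda>p :: real. 6 :: real)" "dgb = (\<lambda>p :: real. 0 :: real)"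
  note gb = this
  define R where "R = (\<lambda>p. 9 * (cubic_beta p * (1 - cubic_beta p)))"
  have ga_pos: "ga p > 0" if "0 \<le> p" for p using that by (simp add: ga_def)
  have A: "(pull_y ga cubic_alpha has_real_derivative pull_v ga dga cubic_alpha p / h_cubic p) (at p)"
     "(pull_v ga dga cubic_alpha has_real_derivative R p * pull_y ga cubic_alpha p / h_cubic p) (at p)"
     if p: "0 < p" "p < 1" for p
  proof -
    have h: "h_cubic p > 0" by (rule h_cubic_pos[OF p])
    have lam: "(cubic_alpha has_real_derivative ga p * (cubic_alpha p * (1 - cubic_alpha p)) / h_cubic p) (at p)"
      unfolding ga_def by (rule DERIV_cubic_alpha[OF p])
    have dg: "(ga has_real_derivative dga p / h_cubic p) (at p)"
    proof -
      have "dga p / h_cubic p = 8 * (1 + 2 * p)" using h by (simp add: dga_def)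
      then show ?thesis unfolding ga_def
        by (auto intro!: derivative_eq_intros)
    qed
    have "((\<lambda>p. 16 * p + 40 * p^2 - 40 * p^4 - 16 * p^5) has_real_derivative (16 + 80 * p - 160 * p^3 - 80 * p^4)) (at p)"
      by (rule derivative_eq_intros refl)+ simp
    moreover have "dga = (\<lambda>p. 16 * p + 40 * p^2 - 40 * p^4 - 16 * p^5)"
      by (simp add: dga_def h_cubic_def fun_eq_iff algebra_simps eval_nat_numeral)
    ultimately have ddg: "(dga has_real_derivative h_cubic p * (16 + 80 * p - 160 * p^3 - 80 * p^4) / h_cubic p) (at p)"
      using h by simp
    have pot: "4 * R p * (ga p)\<^sup>2 = - 2 * ga p * (h_cubic p * (16 + 80 * p - 160 * p^3 - 80 * p^4)) + 3 * (dga p)\<^sup>2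
       + (ga p) ^ 4 * (cubic_alpha p * (1 - cubic_alpha p))"
      unfolding R_def ga_def dga_def using p by (intro cubic_potential) simp
    have gp: "ga p > 0" using ga_pos p by simp
    show "(pull_y ga cubic_alpha has_real_derivative pull_v ga dga cubic_alpha p / h_cubic p) (at p)"
      "(pull_v ga dga cubic_alpha has_real_derivative R p * pull_y ga cubic_alpha p / h_cubic p) (at p)"
      using pull_y_v_DERIV[OF lam dg ddg gp cubic_bounds(1,2)[OF p] h pot] by blast+
  qed
  have B: "(pull_y gb cubic_beta has_real_derivative pull_v gb dgb cubic_beta p / h_cubic p) (at p)"
     "(pull_v gb dgb cubic_beta has_real_derivative R p * pull_y gb cubic_beta p / h_cubic p) (at p)"
     if p: "0 < p" "p < 1" for p
  proof -
    have h: "h_cubic p > 0" by (rule h_cubic_pos[OF p])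
    have lam: "(cubic_beta has_real_derivative gb p * (cubic_beta p * (1 - cubic_beta p)) / h_cubic p) (at p)"
      unfolding gb by (rule DERIV_cubic_beta[OF p])
    have dg: "(gb has_real_derivative dgb p / h_cubic p) (at p)" "(dgb has_real_derivative 0 / h_cubic p) (at p)"
      unfolding gb by simp_all
    have pot: "4 * R p * (gb p)\<^sup>2 = - 2 * gb p * 0 + 3 * (dgb p)\<^sup>2 + (gb p) ^ 4 * (cubic_beta p * (1 - cubic_beta p))"
      by (simp add: R_def gb)
    have gp: "gb p > 0" by (simp add: gb)
    show "(pull_y gb cubic_beta has_real_derivative pull_v gb dgb cubic_beta p / h_cubic p) (at p)"
      "(pull_v gb dgb cubic_beta has_real_derivative R p * pull_y gb cubic_beta p / h_cubic p) (at p)"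
      using pull_y_v_DERIV[OF lam dg gp cubic_bounds(3,4)[OF p] h pot] by blast+
  qed
  have ca: "continuous_on {0..<1} cubic_alpha" and cb: "continuous_on {0..<1} cubic_beta"
    unfolding cubic_alpha_def[abs_def] cubic_beta_def[abs_def] by (intro continuous_intros; force)+
  have FG: "continuous_on {0..<1} (\<lambda>p. hypF (cubic_alpha p))" "continuous_on {0..<1} (\<lambda>p. hypG (cubic_alpha p))"
     "continuous_on {0..<1} (\<lambda>p. hypF (cubic_beta p))" "continuous_on {0..<1} (\<lambda>p. hypG (cubic_beta p))"
    by (rule continuous_on_compose2[OF continuous_on_hypF ca] continuous_on_compose2[OF continuous_on_hypG ca]
       continuous_on_compose2[OF continuous_on_hypF cb] continuous_on_compose2[OF continuous_on_hypG cb];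
       use cubic_image in auto)+
  have cg: "continuous_on {0..<1} ga" "continuous_on {0..<1} dga"
    unfolding ga_def dga_def h_cubic_def by (intro continuous_intros)+
  have nz: "\<forall>p\<in>{0..<1}. sqrt (ga p) \<noteq> 0" "\<forall>p\<in>{0..<1}. 2 * ga p * sqrt (ga p) \<noteq> 0"
    using ga_pos by force+
  have "pull_y gb cubic_beta p / pull_y ga cubic_alpha p = pull_y gb cubic_beta 0 / pull_y ga cubic_alpha 0"
  proof (rule proportional_solutions[where r = 1 and h = h_cubic and R = R
        and v = "pull_v ga dga cubic_alpha" and u = "pull_v gb dgb cubic_beta"])
    show "continuous_on {0..<1} (pull_y ga cubic_alpha)" "continuous_on {0..<1} (pull_v ga dga cubic_alpha)"
      "continuous_on {0..<1} (pull_y gb cubic_beta)" "continuous_on {0..<1} (pull_v gb dgb cubic_beta)"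
      unfolding pull_y_def[abs_def] pull_v_def[abs_def] gb by (intro continuous_intros FG cg nz; simp)+
    show "pull_y ga cubic_alpha q > 0" if "0 \<le> q" "q < 1" for q
      unfolding pull_y_def using cubic_image(1)[OF that] ga_pos[OF that(1)]
      by (auto intro!: divide_pos_pos hypF_pos)
    show "pull_v ga dga cubic_alpha 0 = 0" "pull_v gb dgb cubic_beta 0 = 0"
      by (simp_all add: pull_v_def cubic_alpha_def cubic_beta_def hypG_0 dga_def h_cubic_def gb)
  qed (use A B assms h_cubic_pos in blast)+
  moreover have "sqrt (ga p) = sqrt 2 * (1 + 2 * p)" "ga 0 = 2"
    using assms by (simp_all add: ga_def real_sqrt_mult)
  ultimately have "(hypF (cubic_beta p) / sqrt 6) / (hypF (cubic_alpha p) / (sqrt 2 * (1 + 2 * p)))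
      = (1 / sqrt 6) / (1 / sqrt 2)"
    by (simp add: pull_y_def gb cubic_alpha_def[of 0] cubic_beta_def[of 0] hypF_0)
  then have "(1 + 2 * p) * hypF (cubic_beta p) / hypF (cubic_alpha p) * (sqrt 2 / sqrt 6) = 1 * (sqrt 2 / sqrt 6)"
    by (simp add: mult_ac)
  then have "(1 + 2 * p) * hypF (cubic_beta p) / hypF (cubic_alpha p) = 1"
    by (subst (asm) mult_right_cancel) auto
  then show ?thesis by simp
qed

lemma cubic_transformation_DERIV:
  assumes p: "0 < p" "p < 1"
  shows "(1 + 2 * p)\<^sup>2 * hypG (cubic_alpha p)
     = h_cubic p * hypF (cubic_beta p) + 3 * (1 + 2 * p) * hypG (cubic_beta p)"
proof -
  note bd = cubic_bounds[OF p]
  have h: "h_cubic p > 0" by (rule h_cubic_pos[OF p])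
  have A: "((\<lambda>p. hypF (cubic_alpha p)) has_real_derivative 2 * (1 + 2 * p)\<^sup>2 * hypG (cubic_alpha p) / h_cubic p) (at p)"
    by (rule DERIV_cong[OF DERIV_chain2[where f = hypF and g = cubic_alpha, OF DERIV_hypF DERIV_cubic_alpha[OF p]]])
      (use bd h in \<open>auto simp: field_simps\<close>)
  have B: "((\<lambda>p. hypF (cubic_beta p)) has_real_derivative 6 * hypG (cubic_beta p) / h_cubic p) (at p)"
    by (rule DERIV_cong[OF DERIV_chain2[where f = hypF and g = cubic_beta, OF DERIV_hypF DERIV_cubic_beta[OF p]]])
      (use bd h in \<open>auto simp: field_simps\<close>)
  have C: "((\<lambda>p. (1 + 2 * p) * hypF (cubic_beta p)) has_real_derivative
      2 * hypF (cubic_beta p) + 6 * hypG (cubic_beta p) / h_cubic p * (1 + 2 * p)) (at p)"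
    by (rule DERIV_mult[OF _ B]) (rule derivative_eq_intros refl | simp)+
  have "eventually (\<lambda>q. q \<in> {0<..<1}) (nhds p)"
    using p by (intro eventually_nhds_in_open) auto
  then have ev: "eventually (\<lambda>q. hypF (cubic_alpha q) = (1 + 2 * q) * hypF (cubic_beta q)) (nhds p)"
    by eventually_elim (auto intro: cubic_transformation)
  from DERIV_unique[OF A C[folded DERIV_cong_ev[OF refl ev refl]]] show ?thesis
    using h by (simp add: field_simps)
qed

section \<open>The evaluation at the CM point\<close>

lemma sqrt3_bounds: "173 / 100 < sqrt (3 :: real)" "sqrt (3 :: real) < 7 / 4"
  by (rule real_less_rsqrt real_less_lsqrt; simp add: power2_eq_square)+

lemma sqrt5_bounds: "2 < sqrt (5 :: real)" "sqrt (5 :: real) < 5 / 2"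
  by (rule real_less_rsqrt real_less_lsqrt; simp add: power2_eq_square)+

text \<open>
  The point \<open>tau = i sqrt(3/20)\<close>, where the lambda functions above belong to the period ratios
  \<open>K'/K = sqrt(3/5)\<close> and \<open>K'/K = sqrt 15\<close>. Dually, \<open>1 - mu (-1) x15\<close> has period ratio \<open>1 / sqrt 15\<close>, one third of
  the first ratio \<open>3 / sqrt 15\<close>, and so it is its cubic transform; \<open>p15\<close> is the parameter of that transformation, the
  positive root of \<open>4 p (2 + p) = (2 + sqrt 3) (1 + 2p)\<close>.
\<close>

definition x15 :: real where "x15 = 7 - 4 * sqrt 3"

definition p15 :: real where "p15 = (sqrt 3 - 2 + sqrt 3 * sqrt 5) / 4"

lemma sqrt3_reduce: "sqrt 3 * sqrt 3 = (3 :: real)" "sqrt 3 * (sqrt 3 * z) = 3 * (z :: real)"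
  by (simp_all flip: mult.assoc)

lemma x15_bounds: "0 < x15" "x15 < 1 / 12"
  using sqrt3_bounds by (simp_all add: x15_def)

lemma root20_x15: "root20 x15 = 4 * sqrt 5 * x15"
proof -
  have "quart x15 = 80 * x15\<^sup>2"
    by (simp add: quart_def x15_def algebra_simps eval_nat_numeral sqrt3_reduce)
  also have "\<dots> = (4 * sqrt 5 * x15)\<^sup>2"
    by (simp add: power_mult_distrib)
  finally show ?thesis using x15_bounds by (simp add: root20_def)
qed

text \<open>
  Used with \<open>v = sqrt 5\<close> and \<open>v = - sqrt 5\<close>: on the curve above \<open>x15\<close> the two values of \<open>s\<close> are \<open>4 v x15\<close>.
\<close>

lemma level20_values:
  assumes v: "v * v = 5"
  shows "lam20 (4 * v * x15) x15 = 1 / 2 + 7 / 32 * sqrt 3 - sqrt 3 * v / 32"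
    and "g20 (4 * v * x15) x15 = (1 + x15) ^ 3 * (5 - v) / 2"
    and "dg20 (4 * v * x15) x15 = (208 * sqrt 3 - 360 + (1164 - 672 * sqrt 3) * v) * g20 (4 * v * x15) x15"
proof -
  have v': "v * (v * z) = 5 * z" for z
    using v by (simp flip: mult.assoc)
  note red = algebra_simps eval_nat_numeral sqrt3_reduce v v'
  have "(1 + x15)^5 + 16 * x15 * (1 - x15) * (1 + x15^2) - (1 - x15) * (1 - 6 * x15 + x15^2) * (4 * v * x15)
     = (1 / 2 + 7 / 32 * sqrt 3 - sqrt 3 * v / 32) * (2 * (1 + x15) ^ 5)"
    by (simp add: x15_def red)
  then show "lam20 (4 * v * x15) x15 = 1 / 2 + 7 / 32 * sqrt 3 - sqrt 3 * v / 32"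
    unfolding lam20_def using x15_bounds by simp
  show g: "g20 (4 * v * x15) x15 = (1 + x15) ^ 3 * (5 - v) / 2"
    by (simp add: g20_def x15_def red)
  show "dg20 (4 * v * x15) x15 = (208 * sqrt 3 - 360 + (1164 - 672 * sqrt 3) * v) * g20 (4 * v * x15) x15"
    by (simp add: g20_def dg20_def x15_def red)
qed

lemma p15_bounds: "0 < p15" "p15 < 1"
proof -
  have "sqrt 3 * sqrt 5 < 7 / 4 * (5 / 2 :: real)" "173 / 100 * 2 < sqrt 3 * sqrt (5 :: real)"
    using sqrt3_bounds sqrt5_bounds by (intro mult_strict_mono; simp)+
  moreover have "sqrt 3 * sqrt 5 < (4 :: real)"
    unfolding real_sqrt_mult[symmetric] by (rule real_less_lsqrt) auto
  ultimately show "0 < p15" "p15 < 1"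
    using sqrt3_bounds by (simp_all add: p15_def)
qed

lemma cubic_values:
  shows "cubic_alpha p15 = 1 / 2 + 7 / 32 * sqrt 3 + sqrt 3 * sqrt 5 / 32"
    and "cubic_beta p15 = 1 / 2 + 7 / 32 * sqrt 3 - sqrt 3 * sqrt 5 / 32"
    and "h_cubic p15 = (1 + 2 * p15)\<^sup>2 / 16"
    and "1 + 2 * p15 = sqrt 3 * (1 + sqrt 5) / 2"
proof -
  define t u :: real where "t = sqrt 3" "u = sqrt 5"
  note tu = this
  have red: "t * t = 3" "t * (t * z) = 3 * z" "u * u = 5" "u * (u * z) = 5 * z" for z
    by (simp_all add: tu flip: mult.assoc)
  have p: "p15 = (t - 2 + t * u) / 4" by (simp add: p15_def tu)
  show P: "1 + 2 * p15 = sqrt 3 * (1 + sqrt 5) / 2"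
    unfolding p tu[symmetric] by (simp add: field_simps)
  have nz: "1 + 2 * p15 \<noteq> 0" using p15_bounds by simp
  show "cubic_alpha p15 = 1 / 2 + 7 / 32 * sqrt 3 + sqrt 3 * sqrt 5 / 32"
    unfolding cubic_alpha_def nonzero_divide_eq_eq[OF power_not_zero[OF nz]]
    unfolding P tu[symmetric] by (simp add: p algebra_simps add_divide_distrib diff_divide_distrib eval_nat_numeral red)
  show "cubic_beta p15 = 1 / 2 + 7 / 32 * sqrt 3 - sqrt 3 * sqrt 5 / 32"
    unfolding cubic_beta_def nonzero_divide_eq_eq[OF nz]
    unfolding P tu[symmetric] by (simp add: p algebra_simps add_divide_distrib diff_divide_distrib eval_nat_numeral red)
  show "h_cubic p15 = (1 + 2 * p15)\<^sup>2 / 16"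
    unfolding P h_cubic_def tu[symmetric] by (simp add: p algebra_simps add_divide_distrib diff_divide_distrib eval_nat_numeral red)
qed

context level20_sequence
begin

text \<open>
  At the CM point \<open>F(lam_1)\<close>, \<open>F(lam_5)\<close> and \<open>F(1 - lam_5)\<close> are algebraic multiples of one another, and their
  logarithmic derivatives are related by affine maps with algebraic coefficients. Substituting this into the Legendre relation for \<open>lam_5\<close> leaves a linear
  combination of \<open>Z\<close> and \<open>theta Z\<close> with coefficients in \<open>Q(sqrt 3, sqrt 5)\<close>; \<open>sqrt 5\<close> cancels.
\<close>

lemma ramanujan_identity:
  "16 * sqrt 3 * (2 - sqrt 3) ^ 3 * genfun 1 x15 + (1104 * sqrt 3 - 1912) * genfun 0 x15 = 1 / pi"
proof -
  define t u where "t = sqrt (3 :: real)" "u = sqrt (5 :: real)"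
  note tu = this
  have red: "t * t = 3" "t * (t * z) = 3 * z" "u * u = 5" "u * (u * z) = 5 * z" for z
    by (simp_all add: tu flip: mult.assoc)
  define x Z W y where "x = x15" "Z = genfun 0 x15" "W = (1 + x15) * root20 x15 * genfun 1 x15" "y = 1 + x15"
  note abbr = this
  have y: "y > 0" using x15_bounds by (simp add: abbr)
  have u: "2 < u" "u < 5 / 2" using sqrt5_bounds by (simp_all add: tu)
  define f1 G1 f5 G5 where fG: "f1 = hypF (mu 1 x15)" "G1 = hypG (mu 1 x15)"
    "f5 = hypF (mu (-1) x15)" "G5 = hypG (mu (-1) x15)"
  have r: "root20 x15 = 4 * u * x15" "- root20 x15 = 4 * (- u) * x15"
    by (simp_all add: root20_x15 tu)
  have uu: "u * u = 5" "(- u) * (- u) = 5" by (simp_all add: red)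
  note v1 = level20_values[OF uu(1)] and v5 = level20_values[OF uu(2)]
  have g: "gmu 1 x15 = y ^ 3 * (5 - u) / 2" "gmu (-1) x15 = y ^ 3 * (5 + u) / 2"
    using v1(2) v5(2) by (simp_all add: gmu_def r abbr)
  have gpos: "gmu 1 x15 > 0" "gmu (-1) x15 > 0" unfolding g using y u by simp_all
  define D1 D5 where D: "D1 = 208 * t - 360 + (1164 - 672 * t) * u" "D5 = 360 - 208 * t + (1164 - 672 * t) * u"
  have D1: "dgmu 1 x15 / gmu 1 x15 = D1"
    using v1(3) gpos unfolding dgmu_def gmu_def by (simp add: r D tu)
  have D5: "dgmu (-1) x15 / gmu (-1) x15 = D5"
    using v5(3) gpos unfolding dgmu_def gmu_def by (simp add: r D tu field_simps)
  have Z1: "gmu 1 x15 * Z = f1\<^sup>2" and Z5: "gmu (-1) x15 * Z = 5 * f5\<^sup>2"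
    using genfun_0_eq_hypF[of 1 x15] genfun_0_eq_hypF[of "-1" x15] x15_bounds by (simp_all add: fG abbr)
  have W1: "f1 * G1 = (W + D1 * Z) / 2" and W5: "f5 * G5 = (W + D5 * Z) / 10"
    using genfun_1_eq_hypF[of 1 x15] genfun_1_eq_hypF[of "-1" x15] x15_bounds unfolding D1 D5
    by (simp_all add: fG abbr)
  have fpos: "f1 > 0" "f5 > 0"
    using mu_bounds[of 1 x15] mu_bounds[of "-1" x15] x15_bounds by (auto simp: fG intro!: hypF_pos)
  have Zpos: "Z > 0"
    using Z1 fpos gpos zero_less_mult_pos[of "gmu 1 x15" Z] by simp
  have "(f5 * f1)\<^sup>2 = (gmu 1 x15 * Z) * (gmu (-1) x15 * Z) / 5"
    unfolding Z1 Z5 by (simp add: power_mult_distrib)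
  also have "\<dots> = (gmu 1 x15 * gmu (-1) x15) * Z\<^sup>2 / 5"
    by (simp add: power2_eq_square)
  also have "gmu 1 x15 * gmu (-1) x15 = 5 * y ^ 6"
    using g20_conj_prod[of "root20 x15" x15] root20_sq[of x15] x15_bounds by (simp add: gmu_def abbr)
  also have "5 * y ^ 6 * Z\<^sup>2 / 5 = (y ^ 3 * Z)\<^sup>2" by (simp add: power_mult_distrib flip: power_mult)
  finally have sq: "(f5 * f1)\<^sup>2 = (y ^ 3 * Z)\<^sup>2" .
  \<comment> \<open>Together with \<open>f1 G1\<close> and \<open>f5 G5\<close> this product determines the mixed products in the Legendre relation.\<close>
  have f51: "f5 * f1 = y ^ 3 * Z"
    by (rule power2_eq_imp_eq[OF sq]) (use fpos Zpos y in simp_all)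
  have f5G1: "f5 * G1 = (W + D1 * Z) / (5 - u)"
  proof -
    have "f5 * G1 * (gmu 1 x15 * Z) = (f5 * f1) * (f1 * G1)" unfolding Z1 by (simp add: power2_eq_square)
    also have "\<dots> = y ^ 3 * ((W + D1 * Z) / 2) * Z" unfolding f51 W1 by simp
    finally have "f5 * G1 * gmu 1 x15 = y ^ 3 * ((W + D1 * Z) / 2)" using Zpos by simp
    then have "y ^ 3 * (f5 * G1 * (5 - u)) = y ^ 3 * (W + D1 * Z)" unfolding g by (simp add: mult_ac)
    then show ?thesis using y u by (simp add: nonzero_eq_divide_eq)
  qed
  have f1G5: "f1 * G5 = (W + D5 * Z) / (5 + u)"
  proof -
    have "f1 * G5 * (gmu (-1) x15 * Z) = 5 * ((f5 * f1) * (f5 * G5))" unfolding Z5 by (simp add: power2_eq_square)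
    also have "\<dots> = y ^ 3 * ((W + D5 * Z) / 2) * Z" unfolding f51 W5 by simp
    finally have "f1 * G5 * gmu (-1) x15 = y ^ 3 * ((W + D5 * Z) / 2)" using Zpos by simp
    then have "y ^ 3 * (f1 * G5 * (5 + u)) = y ^ 3 * (W + D5 * Z)" unfolding g by (simp add: mult_ac)
    then show ?thesis using y u by (simp add: nonzero_eq_divide_eq)
  qed
  have beta: "cubic_beta p15 = mu 1 x15"
    unfolding cubic_values mu_def using v1(1) by (simp add: r tu)
  have alpha: "cubic_alpha p15 = 1 - mu (-1) x15"
    unfolding cubic_values mu_def using v5(1) by (simp add: r tu)
  define P where "P = 1 + 2 * p15"
  have P: "P > 0" "P = t * (1 + u) / 2" using p15_bounds cubic_values(4) by (simp_all add: P_def tu)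
  have Fa: "hypF (1 - mu (-1) x15) = P * f1"
    using cubic_transformation[of p15] p15_bounds unfolding beta alpha by (simp add: fG P_def)
  have "P * (P * hypG (1 - mu (-1) x15)) = P * (P * (f1 / 16) + 3 * G1)"
    using cubic_transformation_DERIV[of p15] p15_bounds unfolding beta alpha cubic_values(3)
    by (simp add: fG P_def power2_eq_square algebra_simps)
  then have Ga: "P * hypG (1 - mu (-1) x15) = P * (f1 / 16) + 3 * G1" using P(1) by simp
  have leg: "1 / pi = f5 * hypG (1 - mu (-1) x15) + hypF (1 - mu (-1) x15) * G5"
    using hypF_legendre[of "mu (-1) x15"] mu_bounds[of "-1" x15] x15_bounds by (simp add: fG)
  have "P * (1 / pi) = f5 * (P * hypG (1 - mu (-1) x15)) + P * (P * f1) * G5"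
    unfolding leg Fa by (simp add: algebra_simps)
  also have "\<dots> = P * (f5 * f1) / 16 + 3 * (f5 * G1) + P\<^sup>2 * (f1 * G5)"
    unfolding Ga by (simp add: algebra_simps power2_eq_square)
  also have "\<dots> = P * (y ^ 3 * Z) / 16 + 3 * ((W + D1 * Z) / (5 - u)) + P\<^sup>2 * ((W + D5 * Z) / (5 + u))"
    unfolding f51 f5G1 f1G5 ..
  also have "3 * ((W + D1 * Z) / (5 - u)) = P * (t * (u - 1) * (5 + u) / 40 * (W + D1 * Z))"
  proof -
    have "P * (t * (u - 1) * (5 + u)) * (5 - u) = 120"
      unfolding P(2) by (simp add: algebra_simps red)
    then have "P * (t * (u - 1) * (5 + u) / 40) * (5 - u) = 3" by simp
    then have inv: "P * (t * (u - 1) * (5 + u) / 40) = 3 / (5 - u)"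
      by (rule nonzero_eq_divide_eq[THEN iffD2, rotated]) (use u in simp)
    have "P * (t * (u - 1) * (5 + u) / 40 * (W + D1 * Z)) = P * (t * (u - 1) * (5 + u) / 40) * (W + D1 * Z)"
      by (simp only: mult.assoc)
    also have "\<dots> = 3 * ((W + D1 * Z) / (5 - u))" unfolding inv by (simp only: times_divide_eq_left times_divide_eq_right)
    finally show ?thesis by (rule sym)
  qed
  also have "P\<^sup>2 * ((W + D5 * Z) / (5 + u)) = P * (t * (1 + u) * (5 - u) / 40 * (W + D5 * Z))"
  proof -
    have "t * (1 + u) * (5 - u) * (5 + u) = 20 * (t * (1 + u))"
      by (simp add: algebra_simps red)
    then have "t * (1 + u) * (5 - u) / 40 * (5 + u) = P" unfolding P(2) by (simp add: mult_ac)
    then have inv: "t * (1 + u) * (5 - u) / 40 = P / (5 + u)"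
      by (rule nonzero_eq_divide_eq[THEN iffD2, rotated]) (use u in simp)
    show ?thesis unfolding inv power2_eq_square
      by (simp only: mult.assoc times_divide_eq_left times_divide_eq_right)
  qed
  finally have "P * (1 / pi) = P * (y ^ 3 * Z / 16 + t * (u - 1) * (5 + u) / 40 * (W + D1 * Z)
     + t * (1 + u) * (5 - u) / 40 * (W + D5 * Z))"
    by (simp add: algebra_simps)
  then have "1 / pi = y ^ 3 * Z / 16 + t * (u - 1) * (5 + u) / 40 * (W + D1 * Z)
     + t * (1 + u) * (5 - u) / 40 * (W + D5 * Z)"
    by (rule mult_left_cancel[THEN iffD1, rotated]) (use P(1) in simp)
  also have "W = 16 * u * (2 - t) ^ 3 * genfun 1 x15"
  proof -
    have "(1 + x15) * (4 * u * x15) = 16 * u * (2 - t) ^ 3"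
      by (simp add: x15_def tu(1)[symmetric] algebra_simps eval_nat_numeral red)
    then show ?thesis by (simp only: abbr(3) r(1))
  qed
  also have "y ^ 3 = 64 * (2 - t) ^ 3"
    by (simp add: abbr(4) x15_def tu[symmetric] algebra_simps eval_nat_numeral)
  finally show ?thesis
    unfolding D abbr(2) tu[symmetric]
    by (simp add: algebra_simps diff_divide_distrib eval_nat_numeral red)
qed

end

theorem mainTheorem5:
  fixes A :: "nat \<Rightarrow> real" and B C :: real
  assumes init: "A 0 = 1" "A 1 = 1" "A 2 = 6" "A 3 = 30" "A 4 = 175" "A 5 = 1087"
    and rec: "\<And>n::nat. n \<ge> 6 \<Longrightarrow>
        (-54 + 54 * real n - 18 * real n ^ 2 + 2 * real n ^ 3) * A (n - 6)
      + (190 - 226 * real n + 90 * real n ^ 2 - 12 * real n ^ 3) * A (n - 5)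
      + (312 - 428 * real n + 204 * real n ^ 2 - 34 * real n ^ 3) * A (n - 4)
      + (168 - 292 * real n + 180 * real n ^ 2 - 40 * real n ^ 3) * A (n - 3)
      + (54 - 122 * real n + 102 * real n ^ 2 - 34 * real n ^ 3) * A (n - 2)
      + (2 - 10 * real n + 18 * real n ^ 2 - 12 * real n ^ 3) * A (n - 1)
      + 2 * real n ^ 3 * A n = 0"
    and B: "B = -16 * (-2 + sqrt 3) * sqrt (3 * (97 - 56 * sqrt 3))"
    and C: "C = 4 * (14 * sqrt (97 - 56 * sqrt 3) - 7 * sqrt (3 * (97 - 56 * sqrt 3))
                     + 3 * (-3064 + 1769 * sqrt 3) * sqrt (97 + 56 * sqrt 3))"
  shows "(\<lambda>n. A n * (B * real n + C) * (7 - 4 * sqrt 3) ^ n) sums (1 / pi)"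
proof -
  interpret level20_sequence A
    by unfold_locales (fact init rec)+
  \<comment> \<open>All nested radicals in \<open>B\<close> and \<open>C\<close> lie in \<open>Q(sqrt 3)\<close>.\<close>
  have "97 - 56 * sqrt 3 = (7 - 4 * sqrt 3)\<^sup>2" "97 + 56 * sqrt 3 = (7 + 4 * sqrt 3)\<^sup>2"
    by (simp_all add: power2_eq_square algebra_simps)
  then have s: "sqrt (97 - 56 * sqrt 3) = 7 - 4 * sqrt 3" "sqrt (97 + 56 * sqrt 3) = 7 + 4 * sqrt 3"
    using sqrt3_bounds by simp_all
  have B': "B = 16 * sqrt 3 * (2 - sqrt 3) ^ 3" and C': "C = 1104 * sqrt 3 - 1912"
    unfolding B C real_sqrt_mult s by (simp_all add: algebra_simps eval_nat_numeral sqrt3_reduce)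
  have "(\<lambda>n. B * (real n ^ 1 * A n * x15 ^ n) + C * (real n ^ 0 * A n * x15 ^ n)) sums (B * genfun 1 x15 + C * genfun 0 x15)"
    using x15_bounds by (intro sums_add sums_mult sums_genfun) auto
  moreover have "B * genfun 1 x15 + C * genfun 0 x15 = 1 / pi"
    unfolding B' C' by (rule ramanujan_identity)
  moreover have "B * (real n ^ 1 * A n * x15 ^ n) + C * (real n ^ 0 * A n * x15 ^ n)
      = A n * (B * real n + C) * (7 - 4 * sqrt 3) ^ n" for n
    by (simp add: x15_def algebra_simps)
  ultimately show ?thesis by simp
qed

end
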